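(* Let $G$ be a second countable compact abelian group and let $A:G\to G$ be a continuous surjective group homomorphism such that $\ker A$ is finite and $\bigcup_{j\in\mathbb{N}_0}\ker A^j$ is dense in $G$; put $m=|\ker A|$. Suppose $(V_j)_{j\in\mathbb{N}_0}$ is an MRA of $L^2(G)$ and $(\varphi_j)_{j\in\mathbb{N}_0}$ is an orthonormal scaling sequence of it. Let $\psi^\nu_j$ ($j\in\mathbb{N}_0$, $\nu=1,\ldots,m-1$) be wavelet functions obtained from $(\varphi_j)$ by the construction described in the context, and let $W^{(\nu)}_j=\operatorname{span}\{T_a\psi^\nu_j: a\in\ker A^j\}$. Then, for any $j\in\mathbb{N}_0$, $$V_{j+1}=V_j\oplus W^{(1)}_j\oplus\cdots\oplus W^{(m-1)}_j$$ (orthogonal direct sum), and the system $(T_a\psi^\nu_j)_{a\in\ker A^j}$ is an orthonormal basis of the space $W^{(\nu)}_j$ for $\nu=1,\ldots,m-1$.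
   Context: $\mathbb{N}_0=\{0,1,2,\ldots\}$, and $A^0$ is the identity map. $\widehat{G}$ is the (discrete) dual group of continuous characters of $G$, written additively, $(\chi_1+\chi_2)(x)=\chi_1(x)\chi_2(x)$, with identity $\mathbf{0}$. For a subgroup $H\subset G$, $H^{\perp}=\{\chi\in\widehat{G}:\chi(h)=1\text{ for all }h\in H\}$. $dx$ is Haar measure on $G$ normalized to total mass $1$, functions are complex-valued, and $\widehat{f}(\chi)=\int_G f(x)\overline{\chi(x)}\,dx$. The adjoint homomorphism is $\widehat{A}(\chi)=\chi\circ A$; one has $(\ker A^j)^\perp=\widehat{A}^j(\widehat{G})$. $T_yf(x)=f(x-y)$, $y\in G$. Periodization: $Pf(x)=\sum_{a\in\ker A}f(y+a)$, where $y\in G$ is any element with $Ay=x$. An MRA of $L^2(G)$ is a sequence $(V_j)_{j\in\mathbb{N}_0}$ of closed subspaces of $L^2(G)$ such that: MR1. $V_j\subset V_{j+1}$ for all $j\in\mathbb{N}_0$; MR2. $\overline{\bigcup_{j=0}^\infty V_j}=L^2(G)$; MR3. for all $j\in\mathbb{N}_0$ and $\gamma\in\ker A^j$, $f\in V_j$ if and only if $T_\gamma f\in V_j$; MR4. for each $j\in\mathbb{N}_0$ there exists $\varphi_j\in V_j$ such that $(T_a\varphi_j)_{a\in\ker A^j}$ is a basis of $V_j$; MR5. for all $j\in\mathbb{N}_0$: a) $f\in V_j\Rightarrow f(A(\cdot))\in V_{j+1}$, and b) $f\in V_{j+1}\Rightarrow Pf\in V_j$. A sequence $(\varphi_j)$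 as in MR4 is a scaling sequence of the MRA; it is called orthonormal if $(T_a\varphi_j)_{a\in\ker A^j}$ is an orthonormal system for every $j\in\mathbb{N}_0$. Digits: $D(A)=\{\pi_0,\pi_1,\ldots,\pi_{m-1}\}\subset\widehat{G}$, with $\pi_0=\mathbf{0}$, contains exactly one representative of each coset of $\widehat{G}/(\ker A)^\perp$; $D(A^0)=\{\mathbf{0}\}$, $D(A^{j+1})=\{\widehat{A}^j\pi+r: r\in D(A^j),\ \pi\in D(A)\}$, a set of representatives of the cosets of $\widehat{G}/(\ker A^{j+1})^\perp$. Construction of the wavelet functions. For a scaling sequence $(\varphi_j)$, for every $j\in\mathbb{N}_0$ and $\eta\in\widehat{G}$ there is a unique number $\mu^{j+1}_\eta$ such that $\widehat{\varphi}_j(\chi)=\mu^{j+1}_\eta\widehat{\varphi}_{j+1}(\chi)$ for all $\chi\in(\ker A^{j+1})^\perp+\eta$. When the scaling sequence is orthonormal, $\sum_{k=0}^{m-1}|\mu^{j+1}_{\eta+\widehat{A}^j\pi_k}|^2=m$. For each $j\in\mathbb{N}_0$ and $\eta\in D(A^j)$ set $b_{0,k}=\mu^{j+1}_{\eta+\widehat{A}^j\pi_k}/\sqrt{m}$, $k=0,\ldots,m-1$, and extend this unit row to an $m\times m$ unitary matrix $B=(b_{\nu,k})_{\nu,k=0}^{m-1}$ (depending on $j$ and $\eta$, and chosen arbitrarily otherwise). Set $\alpha^{\nu,j}_{\eta+\widehat{A}^j\pi_k}=\sqrt{m}\,b_{\nu,k}$ for $\nu=1,\ldots,m-1$, $\eta\in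 D(A^j)$, $k=0,\ldots,m-1$; this defines $\alpha^{\nu,j}_\chi$ for all $\chi\in D(A^{j+1})$, and it is extended to $\widehat{G}$ by $\alpha^{\nu,j}_\chi=\alpha^{\nu,j}_\eta$ for $\chi\in(\ker A^{j+1})^\perp+\eta$, $\eta\in D(A^{j+1})$. Then $\psi^\nu_j$ is defined by $\widehat{\psi}^\nu_j(\chi)=\alpha^{\nu,j}_\chi\,\widehat{\varphi}_{j+1}(\chi)$ for $\chi\in\widehat{G}$. *)

theory Defs
  imports "HOL-Analysis.Analysis"
begin

text \<open>
  The compact group is the carrier of a type; its (Hausdorff) topology and its addition come from
  type classes. Elements of \<open>L\<^sup>2(G)\<close> are represented by square integrable Borel functions, with
  almost everywhere equality in place of equality. All subspaces below that are closed, or spans,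
  are saturated under almost everywhere equality.
\<close>

definition normalized_haar_measure :: "'a::topological_ab_group_add measure \<Rightarrow> bool" where
  "normalized_haar_measure M \<longleftrightarrow>
     sets M = sets borel \<and> emeasure M (space M) = 1 \<and>
     (\<forall>y. \<forall>S\<in>sets M. emeasure M ((\<lambda>x. x + y) ` S) = emeasure M S)"

definition L2 :: "'a measure \<Rightarrow> ('a \<Rightarrow> complex) set" where
  "L2 M = {f \<in> borel_measurable M. integrable M (\<lambda>x. (norm (f x))\<^sup>2)}"

definition l2_inner :: "'a measure \<Rightarrow> ('a \<Rightarrow> complex) \<Rightarrow> ('a \<Rightarrow> complex) \<Rightarrow> complex" where
  "l2_inner M f g = (LINT x|M. f x * cnj (g x))"

definition l2_norm :: "'a measure \<Rightarrow> ('a \<Rightarrow> complex) \<Rightarrow> real" where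
  "l2_norm M f = sqrt (LINT x|M. (norm (f x))\<^sup>2)"

definition l2_closure :: "'a measure \<Rightarrow> ('a \<Rightarrow> complex) set \<Rightarrow> ('a \<Rightarrow> complex) set" where
  "l2_closure M S = {f \<in> L2 M. \<forall>\<epsilon>>0. \<exists>g\<in>S. l2_norm M (\<lambda>x. f x - g x) < \<epsilon>}"

text \<open>The last clause includes saturation: if \<open>f\<close> equals some \<open>g \<in> V\<close> almost everywhere, then
  their distance is \<open>0\<close>, so \<open>f\<close> is in the closure of \<open>V\<close>.\<close>

definition l2_closed_subspace :: "'a measure \<Rightarrow> ('a \<Rightarrow> complex) set \<Rightarrow> bool" where
  "l2_closed_subspace M V \<longleftrightarrow>
     V \<subseteq> L2 M \<and> (\<lambda>x. 0) \<in> V \<and>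
     (\<forall>f\<in>V. \<forall>g\<in>V. (\<lambda>x. f x + g x) \<in> V) \<and>
     (\<forall>c. \<forall>f\<in>V. (\<lambda>x. c * f x) \<in> V) \<and>
     l2_closure M V = V"

definition l2_span :: "'a measure \<Rightarrow> ('i \<Rightarrow> 'a \<Rightarrow> complex) \<Rightarrow> 'i set \<Rightarrow> ('a \<Rightarrow> complex) set" where
  "l2_span M F I = {f \<in> L2 M. \<exists>J c. finite J \<and> J \<subseteq> I \<and>
     (AE x in M. f x = (\<Sum>i\<in>J. c i * F i x))}"

definition l2_independent :: "'a measure \<Rightarrow> ('i \<Rightarrow> 'a \<Rightarrow> complex) \<Rightarrow> 'i set \<Rightarrow> bool" where
  "l2_independent M F I \<longleftrightarrow>
     (\<forall>J c. finite J \<and> J \<subseteq> I \<and> (AE x in M. (\<Sum>i\<in>J. c i * F i x) = 0) \<longrightarrow> (\<forall>i\<in>J. c i = 0))"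

text \<open>Only finite families occur below, so a basis of a closed subspace is a linear basis.\<close>

definition l2_basis ::
  "'a measure \<Rightarrow> ('i \<Rightarrow> 'a \<Rightarrow> complex) \<Rightarrow> 'i set \<Rightarrow> ('a \<Rightarrow> complex) set \<Rightarrow> bool" where
  "l2_basis M F I V \<longleftrightarrow>
     (\<forall>i\<in>I. F i \<in> V) \<and> l2_independent M F I \<and> l2_span M F I = V"

definition l2_orthonormal :: "'a measure \<Rightarrow> ('i \<Rightarrow> 'a \<Rightarrow> complex) \<Rightarrow> 'i set \<Rightarrow> bool" where
  "l2_orthonormal M F I \<longleftrightarrow>
     (\<forall>i\<in>I. F i \<in> L2 M) \<and>
     (\<forall>i\<in>I. \<forall>k\<in>I. l2_inner M (F i) (F k) = (if i = k then 1 else 0))"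

definition l2_orthonormal_basis ::
  "'a measure \<Rightarrow> ('i \<Rightarrow> 'a \<Rightarrow> complex) \<Rightarrow> 'i set \<Rightarrow> ('a \<Rightarrow> complex) set \<Rightarrow> bool" where
  "l2_orthonormal_basis M F I V \<longleftrightarrow> l2_orthonormal M F I \<and> l2_basis M F I V"

text \<open>Used for a finite index set \<open>I\<close>. Uniqueness of the decomposition (almost everywhere)
  follows from orthogonality.\<close>

definition l2_orthogonal_direct_sum ::
  "'a measure \<Rightarrow> ('a \<Rightarrow> complex) set \<Rightarrow> ('i \<Rightarrow> ('a \<Rightarrow> complex) set) \<Rightarrow> 'i set \<Rightarrow> bool" where
  "l2_orthogonal_direct_sum M V U I \<longleftrightarrow>
     (\<forall>i\<in>I. \<forall>k\<in>I. i \<noteq> k \<longrightarrow> (\<forall>f\<in>U i. \<forall>g\<in>U k. l2_inner M f g = 0)) \<and>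
     V = {f \<in> L2 M. \<exists>u. (\<forall>i\<in>I. u i \<in> U i) \<and> (AE x in M. f x = (\<Sum>i\<in>I. u i x))}"

definition dual_group :: "('a::topological_ab_group_add \<Rightarrow> complex) set" where
  "dual_group = {\<xi>. continuous_on UNIV \<xi> \<and> (\<forall>x. norm (\<xi> x) = 1) \<and>
     (\<forall>x y. \<xi> (x + y) = \<xi> x * \<xi> y)}"

text \<open>Additive notation for the pointwise product: \<open>char_zero\<close> is the identity \<open>\<zero>\<close> of the dual group.
  Characters are named \<open>\<xi>\<close> since HOL-Analysis uses the letter chi as a binder.\<close>

definition char_zero :: "'a \<Rightarrow> complex" where
  "char_zero = (\<lambda>x. 1)"

definition char_add :: "('a \<Rightarrow> complex) \<Rightarrow> ('a \<Rightarrow> complex) \<Rightarrow> 'a \<Rightarrow> complex"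
  (infixl "+\<^sub>c" 65) where
  "\<xi>\<^sub>1 +\<^sub>c \<xi>\<^sub>2 = (\<lambda>x. \<xi>\<^sub>1 x * \<xi>\<^sub>2 x)"

definition annihilator :: "'a::topological_ab_group_add set \<Rightarrow> ('a \<Rightarrow> complex) set" where
  "annihilator H = {\<xi> \<in> dual_group. \<forall>h\<in>H. \<xi> h = 1}"

definition char_coset :: "('a \<Rightarrow> complex) set \<Rightarrow> ('a \<Rightarrow> complex) \<Rightarrow> ('a \<Rightarrow> complex) set" where
  "char_coset K \<eta> = {\<xi> +\<^sub>c \<eta> | \<xi>. \<xi> \<in> K}"

definition adjoint_hom :: "('a \<Rightarrow> 'a) \<Rightarrow> ('a \<Rightarrow> complex) \<Rightarrow> 'a \<Rightarrow> complex" where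
  "adjoint_hom A \<xi> = \<xi> \<circ> A"

definition fourier :: "'a measure \<Rightarrow> ('a \<Rightarrow> complex) \<Rightarrow> ('a \<Rightarrow> complex) \<Rightarrow> complex" where
  "fourier M f \<xi> = (LINT x|M. f x * cnj (\<xi> x))"

definition ker_pow :: "('a::zero \<Rightarrow> 'a) \<Rightarrow> nat \<Rightarrow> 'a set" where
  "ker_pow A j = {x. (A ^^ j) x = 0}"

definition translate :: "'a::ab_group_add \<Rightarrow> ('a \<Rightarrow> complex) \<Rightarrow> 'a \<Rightarrow> complex" where
  "translate y f = (\<lambda>x. f (x - y))"

definition periodization ::
  "('a::ab_group_add \<Rightarrow> 'a) \<Rightarrow> ('a \<Rightarrow> complex) \<Rightarrow> 'a \<Rightarrow> complex" where
  "periodization A f = (\<lambda>x. \<Sum>a\<in>ker_pow A 1. f ((SOME y. A y = x) + a))"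

definition scaling_sequence ::
  "'a::topological_ab_group_add measure \<Rightarrow> ('a \<Rightarrow> 'a) \<Rightarrow> (nat \<Rightarrow> ('a \<Rightarrow> complex) set) \<Rightarrow>
    (nat \<Rightarrow> 'a \<Rightarrow> complex) \<Rightarrow> bool" where
  "scaling_sequence M A V \<phi> \<longleftrightarrow>
     (\<forall>j. \<phi> j \<in> V j \<and> l2_basis M (\<lambda>a. translate a (\<phi> j)) (ker_pow A j) (V j))"

definition orthonormal_scaling_sequence ::
  "'a::topological_ab_group_add measure \<Rightarrow> ('a \<Rightarrow> 'a) \<Rightarrow> (nat \<Rightarrow> ('a \<Rightarrow> complex) set) \<Rightarrow>
    (nat \<Rightarrow> 'a \<Rightarrow> complex) \<Rightarrow> bool" where
  "orthonormal_scaling_sequence M A V \<phi> \<longleftrightarrow>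
     scaling_sequence M A V \<phi> \<and>
     (\<forall>j. l2_orthonormal M (\<lambda>a. translate a (\<phi> j)) (ker_pow A j))"

definition MRA ::
  "'a::topological_ab_group_add measure \<Rightarrow> ('a \<Rightarrow> 'a) \<Rightarrow> (nat \<Rightarrow> ('a \<Rightarrow> complex) set) \<Rightarrow> bool" where
  "MRA M A V \<longleftrightarrow>
     (\<forall>j. l2_closed_subspace M (V j)) \<and>
     (\<forall>j. V j \<subseteq> V (Suc j)) \<and>
     l2_closure M (\<Union>j. V j) = L2 M \<and>
     (\<forall>j. \<forall>\<gamma>\<in>ker_pow A j. \<forall>f\<in>L2 M. f \<in> V j \<longleftrightarrow> translate \<gamma> f \<in> V j) \<and>
     (\<forall>j. \<exists>\<phi>\<in>V j. l2_basis M (\<lambda>a. translate a \<phi>) (ker_pow A j) (V j)) \<and>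
     (\<forall>j. (\<forall>f\<in>V j. (\<lambda>x. f (A x)) \<in> V (Suc j)) \<and>
          (\<forall>f\<in>V (Suc j). periodization A f \<in> V j))"

text \<open>\<open>\<pi> 0, \<dots>, \<pi> (m - 1)\<close> with \<open>m = card (ker A)\<close> enumerates, without repetition, a set \<open>D(A)\<close>
  containing exactly one representative of each coset of \<open>(ker A)\<^sup>\<bottom>\<close>.\<close>

definition digit_system ::
  "('a::topological_ab_group_add \<Rightarrow> 'a) \<Rightarrow> (nat \<Rightarrow> 'a \<Rightarrow> complex) \<Rightarrow> bool" where
  "digit_system A \<pi> \<longleftrightarrow>
     \<pi> 0 = char_zero \<and>
     (\<forall>k<card (ker_pow A 1). \<pi> k \<in> dual_group) \<and>
     (\<forall>\<xi>\<in>dual_group. \<exists>!k. k < card (ker_pow A 1) \<and>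
        \<pi> k \<in> char_coset (annihilator (ker_pow A 1)) \<xi>)"

primrec digits ::
  "('a::topological_ab_group_add \<Rightarrow> 'a) \<Rightarrow> (nat \<Rightarrow> 'a \<Rightarrow> complex) \<Rightarrow> nat \<Rightarrow> ('a \<Rightarrow> complex) set" where
  "digits A \<pi> 0 = {char_zero}"
| "digits A \<pi> (Suc j) =
     {(adjoint_hom A ^^ j) (\<pi> k) +\<^sub>c r | k r. k < card (ker_pow A 1) \<and> r \<in> digits A \<pi> j}"

text \<open>\<open>mask M A \<phi> j \<eta>\<close> is the number written \<open>\<mu>\<^sup>j\<^sup>+\<^sup>1\<^sub>\<eta>\<close> (upper index shifted by one).\<close>

definition mask ::
  "'a::topological_ab_group_add measure \<Rightarrow> ('a \<Rightarrow> 'a) \<Rightarrow> (nat \<Rightarrow> 'a \<Rightarrow> complex) \<Rightarrow> nat \<Rightarrow>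
    ('a \<Rightarrow> complex) \<Rightarrow> complex" where
  "mask M A \<phi> j \<eta> =
     (THE \<mu>. \<forall>\<xi>\<in>char_coset (annihilator (ker_pow A (Suc j))) \<eta>.
        fourier M (\<phi> j) \<xi> = \<mu> * fourier M (\<phi> (Suc j)) \<xi>)"

definition unitary_matrix :: "nat \<Rightarrow> (nat \<Rightarrow> nat \<Rightarrow> complex) \<Rightarrow> bool" where
  "unitary_matrix m B \<longleftrightarrow>
     (\<forall>i<m. \<forall>l<m. (\<Sum>k<m. B i k * cnj (B l k)) = (if i = l then 1 else 0)) \<and>
     (\<forall>i<m. \<forall>l<m. (\<Sum>k<m. cnj (B k i) * B k l) = (if i = l then 1 else 0))"

text \<open>\<open>\<psi> \<nu> j\<close> is the function written \<open>\<psi>\<^sup>\<nu>\<^sub>j\<close>; only the indices \<open>1 \<le> \<nu> < m\<close> matter. The matrices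
  \<open>B j \<eta>\<close> are an arbitrary choice of unitary extensions of the prescribed rows.\<close>

definition wavelet_functions ::
  "'a::topological_ab_group_add measure \<Rightarrow> ('a \<Rightarrow> 'a) \<Rightarrow> (nat \<Rightarrow> 'a \<Rightarrow> complex) \<Rightarrow>
    (nat \<Rightarrow> 'a \<Rightarrow> complex) \<Rightarrow> (nat \<Rightarrow> nat \<Rightarrow> 'a \<Rightarrow> complex) \<Rightarrow> bool" where
  "wavelet_functions M A \<pi> \<phi> \<psi> \<longleftrightarrow>
     (let m = card (ker_pow A 1) in
      \<exists>(B :: nat \<Rightarrow> ('a \<Rightarrow> complex) \<Rightarrow> nat \<Rightarrow> nat \<Rightarrow> complex)
       (\<alpha> :: nat \<Rightarrow> nat \<Rightarrow> ('a \<Rightarrow> complex) \<Rightarrow> complex).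
        (\<forall>j. \<forall>\<eta>\<in>digits A \<pi> j.
           unitary_matrix m (B j \<eta>) \<and>
           (\<forall>k<m. B j \<eta> 0 k =
              mask M A \<phi> j (\<eta> +\<^sub>c (adjoint_hom A ^^ j) (\<pi> k)) / of_real (sqrt (real m)))) \<and>
        (\<forall>j. \<forall>\<nu>\<in>{1..<m}. \<forall>\<eta>\<in>digits A \<pi> j. \<forall>k<m.
           \<alpha> \<nu> j (\<eta> +\<^sub>c (adjoint_hom A ^^ j) (\<pi> k)) = of_real (sqrt (real m)) * B j \<eta> \<nu> k) \<and>
        (\<forall>j. \<forall>\<nu>\<in>{1..<m}. \<forall>\<eta>\<in>digits A \<pi> (Suc j).
           \<forall>\<xi>\<in>char_coset (annihilator (ker_pow A (Suc j))) \<eta>. \<alpha> \<nu> j \<xi> = \<alpha> \<nu> j \<eta>) \<and>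
        (\<forall>j. \<forall>\<nu>\<in>{1..<m}. \<psi> \<nu> j \<in> L2 M \<and>
           (\<forall>\<xi>\<in>dual_group. fourier M (\<psi> \<nu> j) \<xi> = \<alpha> \<nu> j \<xi> * fourier M (\<phi> (Suc j)) \<xi>)))"

definition wavelet_space ::
  "'a::topological_ab_group_add measure \<Rightarrow> ('a \<Rightarrow> 'a) \<Rightarrow> (nat \<Rightarrow> nat \<Rightarrow> 'a \<Rightarrow> complex) \<Rightarrow>
    nat \<Rightarrow> nat \<Rightarrow> ('a \<Rightarrow> complex) set" where
  "wavelet_space M A \<psi> \<nu> j = l2_span M (\<lambda>a. translate a (\<psi> \<nu> j)) (ker_pow A j)"

end

theory Submission
  imports Defs "HOL-Complex_Analysis.Great_Picard"
begin

text \<open>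
  Fix a level \<open>j\<close> and put \<open>K = ker A\<^sup>j\<^sup>+\<^sup>1\<close>, \<open>\<Phi> = \<phi>\<^sub>j\<^sub>+\<^sub>1\<close>. The finite group \<open>K\<close> acts on \<open>V\<^sub>j\<^sub>+\<^sub>1\<close> by
  translations, and since the translates of \<open>\<Phi>\<close> are an orthonormal basis this is the regular
  representation. It is diagonalised by the functions \<open>\<Phi>\<^sub>\<eta> = \<Sum>\<^sub>a \<eta>(a) T\<^sub>a\<Phi>\<close> (\<open>isotypic\<close>), one for each
  character \<open>\<eta>\<close> of \<open>K\<close>, that is, for each digit \<open>\<eta> \<in> D(A\<^sup>j\<^sup>+\<^sup>1)\<close>: they are orthogonal, and the Fourier
  transform of \<open>\<Phi>\<^sub>\<eta>\<close> is \<open>card K\<close> times that of \<open>\<Phi>\<close> on the coset of \<open>\<eta>\<close> and zero elsewhere. Hence a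
  function whose transform is \<open>\<beta>\<^sub>\<eta>\<close> times that of \<open>\<Phi>\<close> on the coset of each \<open>\<eta>\<close> is the combination
  \<open>spectral \<beta>\<close> of the \<open>\<Phi>\<^sub>\<eta>\<close>, lies in \<open>V\<^sub>j\<^sub>+\<^sub>1\<close>, and the inner product of two such functions is the
  normalised inner product of their coefficients.

  Both \<open>\<phi>\<^sub>j\<close> (with the mask as coefficients) and the wavelets are of this kind. A digit at level \<open>j + 1\<close> is
  \<open>\<eta> + \<zeta>\<^sub>k\<close>, where \<open>\<eta>\<close> is a digit at level \<open>j\<close> and \<open>\<zeta>\<^sub>k\<close>, the pull-back of the digit \<open>\<pi>\<^sub>k\<close> under
  \<open>A\<^sup>j\<close>, is trivial on \<open>ker A\<^sup>j\<close>. So translation by \<open>a \<in> ker A\<^sup>j\<close> multiplies all \<open>m\<close> coefficients over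
  the same \<open>\<eta>\<close> by the same number, and these coefficients are, up to \<open>\<surd>m\<close>, the rows of a unitary matrix.
  Unitarity in the index \<open>k\<close> together with orthogonality of characters in \<open>\<eta>\<close> makes all translates
  of all \<open>m\<close> functions orthonormal (\<open>wavelet_translates_inner\<close>); unitarity in the row index
  together with Fourier inversion on \<open>ker A\<^sup>j\<close> shows that they span (\<open>spectral_wavelet_expansion\<close>).

  The wavelets are given only by their Fourier transforms, so their identification with these
  combinations rests on the injectivity of the Fourier transform (\<open>fourier_uniqueness\<close>). The existence of enough
  characters is proved here from the dense union of the finite groups \<open>K\<^sub>n = ker A\<^sup>n\<close>. If
  \<open>f \<noteq> 0\<close> had vanishing transform, smoothing gives a continuous function \<open>h\<close> of positive type
  with vanishing transform and \<open>h(0) > 0\<close>. Its coefficients over \<open>K\<^sub>n\<close> are nonnegative with sum \<open>h(0)\<close>, and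
  the sum of their squares is the mean of \<open>\<bar>h\<bar>\<^sup>2\<close> over \<open>K\<^sub>n\<close>, which is bounded below; so some coefficient is at
  least a fixed \<open>\<delta> > 0\<close>. The corresponding isotypic parts of \<open>h\<close> are equicontinuous, and a
  limit of them is a nonzero multiple of a continuous character of the whole group; this
  contradicts that all of them have vanishing transform. The characters of \<open>K\<^sub>n\<close> needed for this are provided by the digits:
  there are as many of them as elements of \<open>K\<^sub>n\<close>, and they differ on \<open>K\<^sub>n\<close>.
\<close>

section \<open>Characters and compact groups\<close>

lemma
  assumes "\<xi> \<in> dual_group"
  shows dual_continuous: "continuous_on UNIV \<xi>"
    and dual_norm: "norm (\<xi> x) = 1"
    and dual_add: "\<xi> (x + y) = \<xi> x * \<xi> y"
  using assms by (auto simp: dual_group_def)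

lemma dual_nonzero: "\<xi> \<in> dual_group \<Longrightarrow> \<xi> x \<noteq> 0"
  using dual_norm[of \<xi> x] by auto

lemma dual_zero: "\<xi> \<in> dual_group \<Longrightarrow> \<xi> 0 = 1"
  using dual_add[of \<xi> 0 0] dual_nonzero[of \<xi> 0] by simp

lemma dual_cnj_mult: "\<xi> \<in> dual_group \<Longrightarrow> \<xi> x * cnj (\<xi> x) = 1"
  by (simp add: complex_norm_square[symmetric] dual_norm)

lemma dual_minus: assumes "\<xi> \<in> dual_group" shows "\<xi> (- x) = cnj (\<xi> x)"
proof -
  have "\<xi> x * \<xi> (- x) = \<xi> x * cnj (\<xi> x)"
    using dual_add[OF assms, of x "- x"] by (simp add: dual_zero[OF assms] dual_cnj_mult[OF assms])
  then show ?thesis using dual_nonzero[OF assms, of x] by simp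
qed

lemma dual_diff: "\<xi> \<in> dual_group \<Longrightarrow> \<xi> (x - y) = \<xi> x * cnj (\<xi> y)"
  using dual_add[of \<xi> x "- y"] by (simp add: dual_minus)

text \<open>
  The tube lemma, applied to the compact factor \<open>UNIV\<close> in the set of pairs \<open>(u, x)\<close> with
  \<open>\<bar>g(x + u) - g(x)\<bar> < \<epsilon>\<close>, replaces the uniform structure of the group.
\<close>
lemma uniformly_continuous_translation:
  fixes g :: "'a::topological_ab_group_add \<Rightarrow> complex"
  assumes "compact (UNIV :: 'a set)" "continuous_on UNIV g" "\<epsilon> > 0"
  shows "\<exists>U. open U \<and> 0 \<in> U \<and> (\<forall>u\<in>U. \<forall>x. norm (g (x + u) - g x) < \<epsilon>)"
proof -
  let ?W = "{p :: 'a \<times> 'a. norm (g (snd p + fst p) - g (snd p)) < \<epsilon>}"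
  have g: "continuous_on UNIV (\<lambda>p. g (f p))" if "continuous_on UNIV f" for f :: "'a \<times> 'a \<Rightarrow> 'a"
    by (rule continuous_on_compose2[OF assms(2) that]) auto
  have "open ?W"
    by (intro open_Collect_less continuous_intros g)
  moreover have "{0} \<times> UNIV \<subseteq> ?W" using assms(3) by auto
  ultimately have "\<exists>X. 0 \<in> X \<and> open X \<and> X \<times> UNIV \<subseteq> ?W"
    by (rule Elementary_Topology.tube_lemma[OF assms(1)])
  then obtain X where "0 \<in> X" "open X" "X \<times> UNIV \<subseteq> ?W"
    by (elim exE conjE)
  then have "norm (g (x + u) - g x) < \<epsilon>" if "u \<in> X" for u x
    using that by (auto dest!: subsetD[of _ _ "(u, x)"])
  then show ?thesis using \<open>0 \<in> X\<close> \<open>open X\<close> by blast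
qed

lemma continuous_if_equicontinuous:
  fixes p :: "'a::topological_ab_group_add \<Rightarrow> complex"
  assumes "\<And>\<epsilon>. \<epsilon> > 0 \<Longrightarrow> \<exists>U. open U \<and> 0 \<in> U \<and> (\<forall>u\<in>U. \<forall>x. norm (p (x + u) - p x) \<le> \<epsilon>)"
  shows "continuous_on UNIV p"
proof -
  have "(p \<longlongrightarrow> p x) (nhds x)" for x
  proof (rule tendstoI)
    fix e :: real assume "e > 0"
    then obtain U where U: "open U" "0 \<in> U" "\<forall>u\<in>U. \<forall>x. norm (p (x + u) - p x) \<le> e / 2"
      using assms[of "e / 2"] by auto
    have "((\<lambda>y. y - x) \<longlongrightarrow> x - x) (nhds x)"
      by (intro tendsto_diff tendsto_const filterlim_ident)
    then have "eventually (\<lambda>y. y - x \<in> U) (nhds x)"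
      using U(1,2) by (intro topological_tendstoD) auto
    then show "eventually (\<lambda>y. dist (p y) (p x) < e) (nhds x)"
    proof eventually_elim
      case (elim y)
      then have "norm (p (x + (y - x)) - p x) \<le> e / 2" using U(3) by blast
      then show ?case using \<open>e > 0\<close> by (simp add: dist_norm)
    qed
  qed
  then show ?thesis
    by (simp add: continuous_on_def tendsto_at_within_iff_tendsto_nhds)
qed

text \<open>
  Every \<open>x\<close> lies in \<open>t + U\<close> for some \<open>t\<close> in the dense union of the \<open>K n\<close>, because the open set \<open>x - U\<close> meets it;
  compactness leaves finitely many \<open>t\<close>, which lie in one \<open>K N\<close>.
\<close>
lemma finitely_many_translates_cover:
  fixes K :: "nat \<Rightarrow> 'a::topological_ab_group_add set"
  assumes "compact (UNIV :: 'a set)"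
    and mono: "\<And>n. K n \<subseteq> K (Suc n)"
    and dense: "closure (\<Union>n. K n) = UNIV"
    and "open U" "U \<noteq> {}"
  shows "\<exists>T N. finite T \<and> (\<forall>n\<ge>N. T \<subseteq> K n) \<and> (\<forall>x. \<exists>t\<in>T. x - t \<in> U)"
proof -
  have inc: "K i \<subseteq> K n" if "i \<le> n" for i n
    using that by (rule lift_Suc_mono_le[where f = K, OF mono])
  let ?C = "(\<lambda>t. (\<lambda>x. x - t) -` U) ` (\<Union>n. K n)"
  have op: "open ((\<lambda>x. x - t) -` U)" for t
    by (intro open_vimage assms continuous_intros)
  have "UNIV \<subseteq> \<Union>?C"
  proof
    fix x :: 'a
    have "open ((\<lambda>t. x - t) -` U)"
      by (intro open_vimage assms continuous_intros)
    moreover obtain u where "u \<in> U" using assms by auto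
    then have "x - u \<in> (\<lambda>t. x - t) -` U" by simp
    ultimately have "(\<lambda>t. x - t) -` U \<inter> (\<Union>n. K n) \<noteq> {}"
      using dense by (metis UNIV_I empty_iff open_Int_closure_eq_empty IntI)
    then show "x \<in> \<Union>?C" by auto
  qed
  then obtain C' where C': "C' \<subseteq> ?C" "finite C'" "UNIV \<subseteq> \<Union>C'"
    using op compactE[OF assms(1), of ?C] by (metis (no_types, lifting) imageE)
  then obtain T where T: "T \<subseteq> (\<Union>n. K n)" "finite T" "C' = (\<lambda>t. (\<lambda>x. x - t) -` U) ` T"
    by (meson finite_subset_image)
  have "\<exists>N. T \<subseteq> K N" using T(2,1)
  proof (induction T)
    case (insert t T)
    then obtain N i where "T \<subseteq> K N" "t \<in> K i" by auto
    then have "insert t T \<subseteq> K (max N i)" using inc[of N "max N i"] inc[of i "max N i"] by auto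
    then show ?case ..
  qed simp
  then obtain N where "T \<subseteq> K N" ..
  then show ?thesis
    using T C'(3) inc by (intro exI[of _ T] exI[of _ N] conjI) blast+
qed

text \<open>
  The convolution of \<open>f\<close> with the reflection of \<open>g\<close>. For \<open>g = cnj \<circ> f\<close> it is the autocorrelation of
  \<open>f\<close>, a function of positive type.
\<close>
definition correlation :: "'a::ab_group_add measure \<Rightarrow> ('a \<Rightarrow> complex) \<Rightarrow> ('a \<Rightarrow> complex) \<Rightarrow> 'a \<Rightarrow> complex" where
  "correlation M f g x = (LINT y|M. f y * g (y - x))"

section \<open>Invariant integration\<close>

locale haar_group =
  fixes M :: "'a::{topological_ab_group_add, t2_space, second_countable_topology} measure"
  assumes compact_UNIV: "compact (UNIV :: 'a set)"
    and haar: "normalized_haar_measure M"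
begin

lemma sets_M [simp]: "sets M = sets borel"
  using haar by (simp add: normalized_haar_measure_def)

lemma space_M [simp]: "space M = UNIV"
  using sets_eq_imp_space_eq[OF sets_M] by simp

lemma emeasure_UNIV [simp]: "emeasure M UNIV = 1"
  using haar by (simp add: normalized_haar_measure_def)

lemma measure_UNIV [simp]: "measure M UNIV = 1"
  by (simp add: measure_def)

sublocale finite_measure M
  by (rule finite_measureI) simp

lemma borel_M: "borel_measurable M = (borel_measurable borel :: ('a \<Rightarrow> 'b::topological_space) set)"
  by (rule measurable_cong_sets) simp_all

lemma continuous_measurable: "continuous_on UNIV (g :: 'a \<Rightarrow> 'b::topological_space) \<Longrightarrow> g \<in> borel_measurable M"
  by (simp add: borel_M borel_measurable_continuous_onI)

lemma shift_measurable [measurable]: "(\<lambda>x. x + y) \<in> measurable M M"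
proof -
  have "(\<lambda>x :: 'a. x + y) \<in> borel_measurable borel"
    by (intro borel_measurable_continuous_onI continuous_intros)
  then show ?thesis by (simp add: measurable_cong_sets[OF sets_M sets_M])
qed

lemma distr_shift: "distr M M (\<lambda>x. x + y) = M"
proof (rule measure_eqI)
  fix S assume "S \<in> sets (distr M M (\<lambda>x. x + y))"
  then have S: "S \<in> sets M" by simp
  have "(\<lambda>x. x + y) -` S = (\<lambda>x. x + (- y)) ` S"
    by (auto simp: image_iff) (metis add_diff_cancel_right')
  moreover have "emeasure M ((\<lambda>x. x + (- y)) ` S) = emeasure M S"
    using S haar unfolding normalized_haar_measure_def by blast
  ultimately show "emeasure (distr M M (\<lambda>x. x + y)) S = emeasure M S"
    by (simp add: emeasure_distr[OF shift_measurable S])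
qed simp

lemma integral_shift:
  fixes f :: "'a \<Rightarrow> 'b::{banach, second_countable_topology}"
  assumes "f \<in> borel_measurable M"
  shows "(LINT x|M. f (x + y)) = (LINT x|M. f x)"
  using integral_distr[OF shift_measurable assms, of y] by (simp add: distr_shift)

lemma integrable_shift:
  fixes f :: "'a \<Rightarrow> 'b::{banach, second_countable_topology}"
  assumes "integrable M f"
  shows "integrable M (\<lambda>x. f (x + y))"
  using integrable_distr[OF shift_measurable[of y], of f] assms by (simp add: distr_shift)

lemma AE_shift:
  assumes "AE x in M. P x"
  shows "AE x in M. P (x + y)"
proof -
  have "AE x in distr M M (\<lambda>x. x + y). P x" using assms by (simp only: distr_shift)
  from AE_distrD[OF shift_measurable this] show ?thesis .
qed

lemma continuous_bounded:
  fixes g :: "'a \<Rightarrow> complex"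
  assumes "continuous_on UNIV g"
  obtains C where "C > 0" "\<And>x. norm (g x) \<le> C"
proof -
  have "bounded (range g)"
    by (intro compact_imp_bounded compact_continuous_image assms compact_UNIV)
  then show ?thesis using that by (auto simp: bounded_pos)
qed

lemma integrable_continuous:
  fixes g :: "'a \<Rightarrow> complex"
  assumes "continuous_on UNIV g"
  shows "integrable M g"
proof -
  obtain C where "\<And>x. norm (g x) \<le> C" using continuous_bounded[OF assms] by blast
  then show ?thesis
    by (intro integrable_const_bound[where B = C] continuous_measurable assms) auto
qed

lemma integrable_mult_continuous:
  fixes f g :: "'a \<Rightarrow> complex"
  assumes f: "integrable M f" and g: "continuous_on UNIV g"
  shows "integrable M (\<lambda>x. f x * g x)"
proof -
  obtain C where C: "\<And>x. norm (g x) \<le> C" using continuous_bounded[OF g] by blast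
  have [measurable]: "f \<in> borel_measurable M" "g \<in> borel_measurable M"
    using f continuous_measurable[OF g] by auto
  show ?thesis
  proof (rule Bochner_Integration.integrable_bound[where f = "\<lambda>x. C * norm (f x)"])
    show "AE x in M. norm (f x * g x) \<le> norm (C * norm (f x))"
    proof (rule AE_I2)
      fix x
      have "norm (f x * g x) \<le> norm (f x) * C"
        by (simp add: norm_mult mult_left_mono C)
      then show "norm (f x * g x) \<le> norm (C * norm (f x))"
        by (simp add: mult.commute)
    qed
  qed (use f in auto)
qed

text \<open>
  Urysohn functions give each point of \<open>U\<close> a continuous function that is positive there and zero off
  \<open>U\<close>. By the Lindelof property countably many of them suffice, and \<open>min 1 (n * (sum of the positive parts of the first n))\<close>
  tends to the indicator.
\<close>
lemma indicator_open_as_limit: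
  assumes "open U"
  obtains G :: "nat \<Rightarrow> 'a \<Rightarrow> real"
  where "\<And>n. continuous_on UNIV (G n)" "\<And>n x. 0 \<le> G n x \<and> G n x \<le> 1"
    "\<And>x. (\<lambda>n. G n x) \<longlonglongrightarrow> indicator U x"
proof -
  have "Hausdorff_space (euclidean :: 'a topology)"
    using hausdorff by (fastforce simp: Hausdorff_space_def disjnt_def)
  then have normal: "normal_space (euclidean :: 'a topology)"
    by (intro compact_Hausdorff_or_regular_imp_normal_space disjI1)
       (auto simp: compact_space_def compact_UNIV)
  have "\<exists>g :: 'a \<Rightarrow> real. continuous_on UNIV g \<and> g x = 1 \<and> (\<forall>y. y \<notin> U \<longrightarrow> g y = 0)" if xU: "x \<in> U" for x
  proof -
    obtain g where "continuous_map euclidean euclideanreal g" "g ` (- U) \<subseteq> {0}" "g ` {x} \<subseteq> {1}"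
    proof (rule Urysohn_lemma_alt[OF normal, of "- U" "{x}" 0 1])
      show "closedin euclidean {x}" by simp
    qed (use assms xU in \<open>auto simp: disjnt_def\<close>)
    then show ?thesis by (intro exI[of _ g]) auto
  qed
  then obtain g :: "'a \<Rightarrow> 'a \<Rightarrow> real" where g: "\<And>x. x \<in> U \<Longrightarrow> continuous_on UNIV (g x)"
    "\<And>x. x \<in> U \<Longrightarrow> g x x = 1" "\<And>x y. x \<in> U \<Longrightarrow> y \<notin> U \<Longrightarrow> g x y = 0"
    by metis
  obtain \<F> where \<F>: "\<F> \<subseteq> (\<lambda>x. {y. g x y > 0}) ` U" "countable \<F>" "\<Union>\<F> = (\<Union>x\<in>U. {y. g x y > 0})"
  proof (rule Lindelof[of "(\<lambda>x. {y. g x y > 0}) ` U"])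
    fix S assume "S \<in> (\<lambda>x. {y. g x y > 0}) ` U"
    then show "open S" using g(1) by (auto intro!: open_Collect_less continuous_intros)
  qed auto
  obtain R where R: "R \<subseteq> U" "countable R" "\<F> = (\<lambda>x. {y. g x y > 0}) ` R"
    using \<F>(1,2) by (metis countable_image_eq countable_subset_image)
  have cover: "\<exists>r\<in>R. g r y > 0" if "y \<in> U" for y
    using that \<F>(3) R(3) g(2)[of y] by force
  show ?thesis
  proof (cases "U = {}")
    case True
    then show ?thesis using that[of "\<lambda>n x. 0"] by auto
  next
    case False
    then have "R \<noteq> {}" using cover by auto
    define r where "r = from_nat_into R"
    have r: "r i \<in> U" for i
      using from_nat_into[OF \<open>R \<noteq> {}\<close>, of i] R(1) unfolding r_def by auto
    have rsurj: "\<exists>i. r i = x" if "x \<in> R" for x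
      using from_nat_into_surj[OF R(2) that] unfolding r_def .
    define G where "G n y = min 1 (real n * (\<Sum>i<n. max 0 (g (r i) y)))" for n y
    show ?thesis
    proof (rule that[of G])
      show "continuous_on UNIV (G n)" for n
        unfolding G_def by (intro continuous_intros g(1)[OF r])
      show "0 \<le> G n x \<and> G n x \<le> 1" for n x
        unfolding G_def by (auto intro!: mult_nonneg_nonneg sum_nonneg)
      show "(\<lambda>n. G n x) \<longlonglongrightarrow> indicator U x" for x
      proof (cases "x \<in> U")
        case False
        then show ?thesis by (simp add: G_def g(3)[OF r])
      next
        case True
        then obtain i where i: "g (r i) x > 0" using cover rsurj by metis
        obtain N where N: "real N * g (r i) x > 1"
          using reals_Archimedean3[OF i] by blast
        have "G n x = 1" if "n \<ge> max N (Suc i)" for n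
        proof -
          have "g (r i) x \<le> (\<Sum>i<n. max 0 (g (r i) x))"
            using member_le_sum[of i "{..<n}" "\<lambda>i. max 0 (g (r i) x)"] that by auto
          then have "1 \<le> real n * (\<Sum>i<n. max 0 (g (r i) x))"
            using N i that
            by (smt (verit) mult_mono of_nat_0_le_iff of_nat_mono max.bounded_iff)
          then show ?thesis by (simp add: G_def)
        qed
        then have "eventually (\<lambda>n. G n x = 1) sequentially"
          unfolding eventually_sequentially by blast
        then show ?thesis using True by (simp add: tendsto_eventually)
      qed
    qed
  qed
qed

text \<open>
  By dominated convergence the integral of \<open>f\<close> over every open set vanishes. The open sets are
  stable under intersection and generate the Borel sets, so the integral over every Borel set vanishes.
\<close>
lemma AE_zero_if_continuous_integrals_zero:
  fixes f :: "'a \<Rightarrow> complex"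
  assumes f: "integrable M f"
    and zero: "\<And>g. continuous_on UNIV g \<Longrightarrow> (LINT x|M. f x * g x) = 0"
  shows "AE x in M. f x = 0"
proof (rule density_zero[OF f])
  have [measurable]: "f \<in> borel_measurable M" using f by auto
  have int0: "(LINT x|M. f x) = 0"
    using zero[of "\<lambda>x. 1"] by simp
  fix S assume "S \<in> sets M"
  then have S: "S \<in> sigma_sets UNIV {U :: 'a set. open U}"
    by (simp add: sets_borel)
  have "Int_stable {U :: 'a set. open U}" "{U :: 'a set. open U} \<subseteq> Pow UNIV"
    by (auto simp: Int_stable_def)
  from this S show "set_lebesgue_integral M S f = 0"
  proof (induction rule: sigma_sets_induct_disjoint)
    case (basic U)
    then obtain G :: "nat \<Rightarrow> 'a \<Rightarrow> real" where G: "\<And>n. continuous_on UNIV (G n)" "\<And>n x. 0 \<le> G n x \<and> G n x \<le> 1"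
      "\<And>x. (\<lambda>n. G n x) \<longlonglongrightarrow> indicator U x" using indicator_open_as_limit[of U] by blast
    have [measurable]: "G n \<in> borel_measurable M" for n by (rule continuous_measurable[OF G(1)])
    have [measurable]: "U \<in> sets M" using basic by simp
    have "(\<lambda>n. LINT x|M. G n x *\<^sub>R f x) \<longlonglongrightarrow> (LINT x|M. indicator U x *\<^sub>R f x)"
    proof (rule integral_dominated_convergence[where w = "\<lambda>x. norm (f x)"])
      show "AE x in M. (\<lambda>n. G n x *\<^sub>R f x) \<longlonglongrightarrow> indicator U x *\<^sub>R f x"
        by (intro AE_I2 tendsto_intros G)
      show "AE x in M. norm (G n x *\<^sub>R f x) \<le> norm (f x)" for n
        using G(2) by (intro AE_I2) (simp add: mult_left_le_one_le)
    qed (use f in auto)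
    moreover have "(LINT x|M. G n x *\<^sub>R f x) = 0" for n
      using zero[of "\<lambda>x. of_real (G n x)"] G(1)[of n]
      by (simp add: scaleR_conv_of_real mult.commute continuous_on_of_real)
    ultimately show ?case
      by (simp add: set_lebesgue_integral_def LIMSEQ_const_iff)
  next
    case empty
    show ?case by (simp add: set_lebesgue_integral_def)
  next
    case (compl A)
    then have A: "A \<in> sets M" by (simp add: sets_borel)
    have "(LINT x|M. f x) = (LINT x|M. indicator A x *\<^sub>R f x + indicator (UNIV - A) x *\<^sub>R f x)"
      by (intro Bochner_Integration.integral_cong) (auto simp: indicator_def)
    also have "\<dots> = (LINT x|M. indicator A x *\<^sub>R f x) + (LINT x|M. indicator (UNIV - A) x *\<^sub>R f x)"
      by (intro Bochner_Integration.integral_add integrable_mult_indicator f)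
         (use A in \<open>auto intro: sets.compl_sets\<close>)
    finally show ?case using compl int0 by (simp add: set_lebesgue_integral_def)
  next
    case (union A)
    have "A i \<in> sets M" for i using union(2) by (auto simp: sets_borel)
    then have "(LINT x:(\<Union>i. A i)|M. f x) = (\<Sum>i. (LINT x:(A i)|M. f x))"
      using union(1) f
      by (intro lebesgue_integral_countable_add)
         (auto simp: disjoint_family_on_def set_integrable_def intro!: integrable_mult_indicator)
    then show ?case using union by simp
  qed
qed

lemma correlation_continuous:
  assumes f: "integrable M f" and g: "continuous_on UNIV g"
  shows "continuous_on UNIV (correlation M f g)"
proof (rule continuous_if_equicontinuous)
  fix \<epsilon> :: real assume "\<epsilon> > 0"
  define I where "I = (LINT x|M. norm (f x))"
  have "I \<ge> 0" unfolding I_def by simp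
  then have "\<epsilon> / (I + 1) > 0" using \<open>\<epsilon> > 0\<close> by simp
  from uniformly_continuous_translation[OF compact_UNIV g this] obtain U where
    U: "open U" "0 \<in> U" "\<And>u x. u \<in> U \<Longrightarrow> norm (g (x + u) - g x) < \<epsilon> / (I + 1)" by blast
  have gs: "continuous_on UNIV (\<lambda>y. g (y - x))" for x
    by (rule continuous_on_compose2[OF g]) (auto intro: continuous_intros)
  have "norm (correlation M f g (x + u) - correlation M f g x) \<le> \<epsilon>" if "u \<in> U" for x u
  proof -
    have "correlation M f g (x + u) - correlation M f g x =
        (LINT y|M. f y * g (y - (x + u)) - f y * g (y - x))"
      unfolding correlation_def
      by (rule Bochner_Integration.integral_diff[symmetric])
         (intro integrable_mult_continuous f gs)+
    also have "norm \<dots> \<le> (LINT y|M. norm (f y * g (y - (x + u)) - f y * g (y - x)))"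
      by (rule Bochner_Integration.integral_norm_bound)
    also have "\<dots> \<le> (LINT y|M. norm (f y) * (\<epsilon> / (I + 1)))"
    proof (rule Bochner_Integration.integral_mono)
      show "integrable M (\<lambda>y. norm (f y * g (y - (x + u)) - f y * g (y - x)))"
        by (intro integrable_norm Bochner_Integration.integrable_diff integrable_mult_continuous f gs)
      show "integrable M (\<lambda>y. norm (f y) * (\<epsilon> / (I + 1)))"
        using f by simp
      fix y
      have "norm (g (y - x) - g (y - (x + u))) \<le> \<epsilon> / (I + 1)"
        using U(3)[OF that, of "y - (x + u)"] by (simp add: algebra_simps)
      then have "norm (g (y - (x + u)) - g (y - x)) \<le> \<epsilon> / (I + 1)"
        by (simp add: norm_minus_commute)
      then show "norm (f y * g (y - (x + u)) - f y * g (y - x)) \<le> norm (f y) * (\<epsilon> / (I + 1))"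
        by (simp only: right_diff_distrib[symmetric] norm_mult mult_left_mono norm_ge_zero)
    qed
    also have "\<dots> = I * (\<epsilon> / (I + 1))" unfolding I_def by simp
    also have "\<dots> \<le> \<epsilon>" using \<open>I \<ge> 0\<close> \<open>\<epsilon> > 0\<close> by (simp add: field_simps)
    finally show ?thesis .
  qed
  then show "\<exists>U. open U \<and> 0 \<in> U \<and>
      (\<forall>u\<in>U. \<forall>x. norm (correlation M f g (x + u) - correlation M f g x) \<le> \<epsilon>)"
    using U by blast
qed

lemma correlation_shift:
  assumes "f \<in> borel_measurable M" and "continuous_on UNIV g"
  shows "correlation M f g x = (LINT y|M. f (y + x) * g y)"
proof -
  have [measurable]: "(\<lambda>y. g (y - x)) \<in> borel_measurable M"
    by (intro continuous_measurable continuous_on_compose2[OF assms(2)]) (auto intro: continuous_intros)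
  have [measurable]: "f \<in> borel_measurable M" by fact
  show ?thesis
    using integral_shift[of "\<lambda>y. f y * g (y - x)" x] by (simp add: correlation_def)
qed

text \<open>
  The transform of a correlation contains the transform of \<open>f\<close> as a factor (Fubini and
  translation invariance).
\<close>
lemma fourier_correlation_zero:
  assumes f: "integrable M f" and g: "continuous_on UNIV g" and \<xi>: "\<xi> \<in> dual_group"
    and zero: "fourier M f \<xi> = 0"
  shows "fourier M (correlation M f g) \<xi> = 0"
proof -
  interpret pair_sigma_finite M M ..
  obtain C where C: "\<And>x. norm (g x) \<le> C" using continuous_bounded[OF g] by blast
  have C0: "C \<ge> 0" using C[of undefined] norm_ge_zero order_trans by blast
  have [measurable]: "f \<in> borel_measurable M" "g \<in> borel_measurable M" "\<xi> \<in> borel_measurable M"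
    using f continuous_measurable g dual_continuous[OF \<xi>] by auto
  have plus [measurable]: "(\<lambda>p. snd p + fst p) \<in> measurable (M \<Otimes>\<^sub>M M) M"
  proof -
    have "(\<lambda>p :: 'a \<times> 'a. snd p + fst p) \<in> borel_measurable borel"
      by (intro borel_measurable_continuous_onI continuous_intros)
    then have "(\<lambda>p :: 'a \<times> 'a. snd p + fst p) \<in> measurable (borel \<Otimes>\<^sub>M borel) borel"
      by (simp add: borel_prod)
    moreover have "sets (M \<Otimes>\<^sub>M M) = sets (borel \<Otimes>\<^sub>M (borel :: 'a measure))"
      by (intro sets_pair_measure_cong) simp_all
    ultimately show ?thesis by (simp only: measurable_cong_sets[OF _ sets_M])
  qed
  define F where "F x y = f (y + x) * g y * cnj (\<xi> x)" for x y
  have [measurable]: "(\<lambda>p. f (snd p + fst p)) \<in> borel_measurable (M \<Otimes>\<^sub>M M)"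
    using measurable_compose[OF plus, of f borel] by simp
  have cnj\<xi>: "(\<lambda>x. cnj (\<xi> x)) \<in> borel_measurable M"
    by (intro continuous_measurable continuous_on_cnj dual_continuous[OF \<xi>])
  then have [measurable]: "(\<lambda>p. cnj (\<xi> (fst p))) \<in> borel_measurable (M \<Otimes>\<^sub>M M)"
    by (rule measurable_compose[OF measurable_fst])
  have Fm [measurable]: "case_prod F \<in> borel_measurable (M \<Otimes>\<^sub>M M)"
    unfolding F_def case_prod_beta by measurable
  have Fx: "integrable M (F x)" for x
    unfolding F_def
    by (intro Bochner_Integration.integrable_mult_left integrable_mult_continuous integrable_shift f g)
  have bound: "(LINT y|M. norm (F x y)) \<le> C * (LINT y|M. norm (f y))" for x
  proof -
    have "(LINT y|M. norm (F x y)) \<le> (LINT y|M. C * norm (f (y + x)))"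
    proof (rule integral_mono)
      show "integrable M (\<lambda>y. norm (F x y))" using Fx by simp
      show "integrable M (\<lambda>y. C * norm (f (y + x)))" using integrable_shift[OF f] by simp
      fix y
      show "norm (F x y) \<le> C * norm (f (y + x))"
        using mult_left_mono[OF C[of y], of "norm (f (y + x))"]
        by (simp add: F_def norm_mult dual_norm[OF \<xi>] mult.commute)
    qed
    also have "\<dots> = C * (LINT y|M. norm (f y))"
      using integral_shift[of "\<lambda>y. norm (f y)" x] by simp
    finally show ?thesis .
  qed
  have Fi: "integrable (M \<Otimes>\<^sub>M M) (case_prod F)"
  proof (rule Fubini_integrable[OF Fm])
    have "(\<lambda>x. LINT y|M. norm (case_prod F (x, y))) \<in> borel_measurable M"
      by measurable
    then show "integrable M (\<lambda>x. LINT y|M. norm (case_prod F (x, y)))"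
      using bound by (intro integrable_const_bound[where B = "C * (LINT y|M. norm (f y))"]) auto
    show "AE x in M. integrable M (\<lambda>y. case_prod F (x, y))" using Fx by simp
  qed
  have "fourier M (correlation M f g) \<xi> = (LINT x|M. LINT y|M. F x y)"
    by (simp add: fourier_def correlation_shift[OF _ g] F_def)
  also have "\<dots> = (LINT y|M. LINT x|M. F x y)"
    using Fubini_integral[OF Fi] ..
  also have "(\<lambda>y. LINT x|M. F x y) = (\<lambda>y. 0)"
  proof
    fix y
    have "F x y = (f (x + y) * cnj (\<xi> (x + y))) * (g y * \<xi> y)" for x
      using dual_cnj_mult[OF \<xi>, of y] by (simp add: F_def dual_add[OF \<xi>] algebra_simps)
    then have *: "(LINT x|M. F x y) = (LINT x|M. f (x + y) * cnj (\<xi> (x + y))) * (g y * \<xi> y)"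
      by simp
    have "(\<lambda>x. f x * cnj (\<xi> x)) \<in> borel_measurable M"
      using cnj\<xi> by measurable
    then have "(LINT x|M. f (x + y) * cnj (\<xi> (x + y))) = (LINT x|M. f x * cnj (\<xi> x))"
      using integral_shift[of "\<lambda>x. f x * cnj (\<xi> x)" y] by simp
    with * show "(LINT x|M. F x y) = 0" using zero by (simp add: fourier_def)
  qed
  finally show ?thesis by simp
qed

end

context haar_group
begin

text \<open>
  A nonnegative function that is not zero has averages bounded away from zero, over the whole
  group and uniformly over the finite subgroups: finitely many translates of a set where it is large cover the group.
\<close>
lemma translates_lower_bound:
  fixes K :: "nat \<Rightarrow> 'a set" and F :: "'a \<Rightarrow> real"
  assumes "\<And>n. K n \<subseteq> K (Suc n)" "closure (\<Union>n. K n) = UNIV"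
    and cont: "continuous_on UNIV F" and nonneg: "\<And>x. F x \<ge> 0" and pos: "F x0 > 0"
  shows "\<exists>T N. \<exists>\<epsilon>>0. finite T \<and> (\<forall>n\<ge>N. T \<subseteq> K n) \<and> (\<forall>x. (\<Sum>t\<in>T. F (x - t)) \<ge> \<epsilon>)"
proof -
  let ?U = "{x. F x > F x0 / 2}"
  have "open ?U" by (intro open_Collect_less cont continuous_intros)
  moreover have "?U \<noteq> {}" using pos by (auto intro!: exI[of _ x0])
  ultimately obtain T N where T: "finite T" "\<forall>n\<ge>N. T \<subseteq> K n" "\<forall>x. \<exists>t\<in>T. x - t \<in> ?U"
    using finitely_many_translates_cover[OF compact_UNIV assms(1,2)] by metis
  have "(\<Sum>t\<in>T. F (x - t)) \<ge> F x0 / 2" for x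
  proof -
    obtain t where t: "t \<in> T" "F (x - t) > F x0 / 2" using T(3) by blast
    have "F (x - t) \<le> (\<Sum>t\<in>T. F (x - t))"
      using t(1) T(1) nonneg by (intro member_le_sum) auto
    with t show ?thesis by simp
  qed
  then show ?thesis using T pos
    by (intro exI[of _ T] exI[of _ N] exI[of _ "F x0 / 2"]) auto
qed

lemma continuous_eq_on_dense:
  fixes p q :: "'a \<Rightarrow> complex"
  assumes "closure S = UNIV" "continuous_on UNIV p" "continuous_on UNIV q"
    and "\<And>x. x \<in> S \<Longrightarrow> p x = q x"
  shows "p x = q x"
proof -
  have "closed {x. p x = q x}" by (intro closed_Collect_eq assms)
  then have "closure S \<subseteq> {x. p x = q x}" using assms(4) by (intro closure_minimal) auto
  then show ?thesis using assms(1) by auto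
qed

end

section \<open>Fourier analysis over a finite subgroup\<close>

definition finite_subgroup :: "'a::ab_group_add set \<Rightarrow> bool" where
  "finite_subgroup K \<longleftrightarrow> finite K \<and> 0 \<in> K \<and> (\<forall>a\<in>K. \<forall>b\<in>K. a - b \<in> K)"

lemma
  assumes "finite_subgroup K"
  shows finite_subgroup_finite: "finite K"
    and finite_subgroup_zero: "0 \<in> K"
    and finite_subgroup_diff: "a \<in> K \<Longrightarrow> b \<in> K \<Longrightarrow> a - b \<in> K"
    and finite_subgroup_minus: "a \<in> K \<Longrightarrow> - a \<in> K"
    and finite_subgroup_add: "a \<in> K \<Longrightarrow> b \<in> K \<Longrightarrow> a + b \<in> K"
    and finite_subgroup_card: "card K > 0"
proof -
  show "finite K" "0 \<in> K" and d: "a \<in> K \<Longrightarrow> b \<in> K \<Longrightarrow> a - b \<in> K" for a b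
    using assms by (auto simp: finite_subgroup_def)
  then show m: "a \<in> K \<Longrightarrow> - a \<in> K" for a using d[of 0 a] by simp
  show "a \<in> K \<Longrightarrow> b \<in> K \<Longrightarrow> a + b \<in> K" using d[of a "- b"] m[of b] by simp
  show "card K > 0" using \<open>finite K\<close> \<open>0 \<in> K\<close> by (auto simp: card_gt_0_iff)
qed

lemma finite_subgroup_sum_shift:
  assumes "finite_subgroup K" "b \<in> K"
  shows "(\<Sum>a\<in>K. f (a + b)) = (\<Sum>a\<in>K. f a)"
  by (rule sum.reindex_bij_witness[where i = "\<lambda>a. a - b" and j = "\<lambda>a. a + b"])
     (use assms finite_subgroup_add finite_subgroup_diff in auto)

lemma finite_subgroup_sum_minus:
  assumes "finite_subgroup K"
  shows "(\<Sum>a\<in>K. f (- a)) = (\<Sum>a\<in>K. f a)"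
  by (rule sum.reindex_bij_witness[where i = uminus and j = uminus])
     (use assms finite_subgroup_minus in auto)

text \<open>
  The sums over \<open>D\<close> take the values that the sums over the full dual group of \<open>K\<close> take. This is the
  form in which Fourier inversion on \<open>K\<close> uses completeness.
\<close>
definition complete_characters :: "'a::topological_ab_group_add set \<Rightarrow> ('a \<Rightarrow> complex) set \<Rightarrow> bool" where
  "complete_characters K D \<longleftrightarrow> finite D \<and> D \<subseteq> dual_group \<and>
     (\<forall>a\<in>K. (\<Sum>\<eta>\<in>D. \<eta> a) = (if a = 0 then of_nat (card K) else 0))"

text \<open>
  Up to the factor \<open>card K\<close> the projection of \<open>f\<close> to the functions on which a translation by \<open>b \<in> K\<close>
  acts as multiplication by \<open>cnj (\<eta> b)\<close>.
\<close>
definition isotypic :: "'a::ab_group_add set \<Rightarrow> ('a \<Rightarrow> complex) \<Rightarrow> ('a \<Rightarrow> complex) \<Rightarrow> 'a \<Rightarrow> complex" where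
  "isotypic K \<eta> f x = (\<Sum>a\<in>K. \<eta> a * f (x - a))"

lemma isotypic_shift:
  assumes K: "finite_subgroup K" and \<eta>: "\<eta> \<in> dual_group" and b: "b \<in> K"
  shows "isotypic K \<eta> f (x - b) = cnj (\<eta> b) * isotypic K \<eta> f x"
proof -
  have "isotypic K \<eta> f x = (\<Sum>a\<in>K. \<eta> (a + b) * f (x - (a + b)))"
    unfolding isotypic_def by (rule finite_subgroup_sum_shift[OF K b, symmetric])
  also have "\<dots> = \<eta> b * isotypic K \<eta> f (x - b)"
    by (simp add: isotypic_def sum_distrib_left dual_add[OF \<eta>] algebra_simps)
  finally show ?thesis
    using dual_cnj_mult[OF \<eta>, of b] by (simp add: mult.assoc[symmetric] mult.commute[of "cnj _"])
qed

lemma isotypic_inversion: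
  assumes K: "finite_subgroup K" and D: "complete_characters K D" and b: "b \<in> K"
  shows "(\<Sum>\<eta>\<in>D. cnj (\<eta> b) * isotypic K \<eta> f x) = of_nat (card K) * f (x - b)"
proof -
  have "(\<Sum>\<eta>\<in>D. cnj (\<eta> b) * isotypic K \<eta> f x) = (\<Sum>\<eta>\<in>D. \<Sum>a\<in>K. \<eta> (a - b) * f (x - a))"
    using D unfolding isotypic_def sum_distrib_left complete_characters_def
    by (intro sum.cong refl) (auto simp: dual_diff)
  also have "\<dots> = (\<Sum>a\<in>K. \<Sum>\<eta>\<in>D. \<eta> (a - b) * f (x - a))" by (rule sum.swap)
  also have "\<dots> = (\<Sum>a\<in>K. if a = b then of_nat (card K) * f (x - a) else 0)"
    using D finite_subgroup_diff[OF K _ b]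
    by (intro sum.cong refl) (auto simp: complete_characters_def sum_distrib_right[symmetric])
  also have "\<dots> = of_nat (card K) * f (x - b)"
    using b finite_subgroup_finite[OF K] by (simp add: sum.delta)
  finally show ?thesis .
qed

lemma isotypic_parseval:
  assumes K: "finite_subgroup K" and D: "complete_characters K D"
  shows "(\<Sum>\<eta>\<in>D. (norm (isotypic K \<eta> f x))\<^sup>2) = real (card K) * (\<Sum>a\<in>K. (norm (f (x - a)))\<^sup>2)"
proof -
  have "complex_of_real (\<Sum>\<eta>\<in>D. (norm (isotypic K \<eta> f x))\<^sup>2) =
      (\<Sum>\<eta>\<in>D. isotypic K \<eta> f x * (\<Sum>a\<in>K. cnj (\<eta> a) * cnj (f (x - a))))"
    unfolding of_real_sum complex_norm_square by (simp add: isotypic_def)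
  also have "\<dots> = (\<Sum>\<eta>\<in>D. \<Sum>a\<in>K. (cnj (\<eta> a) * isotypic K \<eta> f x) * cnj (f (x - a)))"
    by (simp add: sum_distrib_left algebra_simps)
  also have "\<dots> = (\<Sum>a\<in>K. \<Sum>\<eta>\<in>D. (cnj (\<eta> a) * isotypic K \<eta> f x) * cnj (f (x - a)))"
    by (rule sum.swap)
  also have "\<dots> = (\<Sum>a\<in>K. of_nat (card K) * f (x - a) * cnj (f (x - a)))"
    by (simp add: sum_distrib_right[symmetric] isotypic_inversion[OF K D])
  also have "\<dots> = of_real (real (card K) * (\<Sum>a\<in>K. (norm (f (x - a)))\<^sup>2))"
    by (simp add: sum_distrib_left mult.assoc complex_norm_square del: of_real_power)
  finally show ?thesis unfolding of_real_eq_iff .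
qed

lemma norm_character_sum_le:
  assumes K: "finite_subgroup K" and \<eta>: "\<eta> \<in> dual_group" and "\<And>a. norm (f a) \<le> C"
  shows "norm (\<Sum>a\<in>K. \<eta> a * f a) \<le> real (card K) * C"
proof -
  have "norm (\<Sum>a\<in>K. \<eta> a * f a) \<le> (\<Sum>a\<in>K. C)"
    by (rule sum_norm_le) (simp add: norm_mult dual_norm[OF \<eta>] assms(3))
  then show ?thesis by simp
qed

section \<open>Injectivity of the Fourier transform\<close>

context haar_group
begin

text \<open>
  Positivity of the coefficients of an autocorrelation: summing over \<open>K\<close> twice turns the coefficient
  at \<open>\<eta>\<close> into the squared norm of an isotypic part of the reflection of \<open>cnj \<circ> k\<close>.
\<close>
lemma autocorrelation_coefficient:
  assumes k: "continuous_on UNIV k" and K: "finite_subgroup K" and \<eta>: "\<eta> \<in> dual_group"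
  shows "of_nat (card K) * isotypic K \<eta> (correlation M k (\<lambda>x. cnj (k x))) 0
       = of_real (LINT y|M. (norm (isotypic K \<eta> (\<lambda>x. cnj (k (- x))) (- y)))\<^sup>2)"
proof -
  let ?h = "correlation M k (\<lambda>x. cnj (k x))"
  have kc: "continuous_on UNIV (\<lambda>x. k (x + a))" "continuous_on UNIV (\<lambda>x. cnj (k (x + a)))" for a
    by (intro continuous_intros continuous_on_compose2[OF k] subset_UNIV)+
  have h: "?h (b - a) = (LINT y|M. k (y + b) * cnj (k (y + a)))" for a b
  proof -
    have "?h (b - a) = (LINT y|M. k (y + (b - a)) * cnj (k y))"
      using k by (intro correlation_shift continuous_measurable continuous_on_cnj)
    also have "\<dots> = (LINT y|M. k (y + a + (b - a)) * cnj (k (y + a)))"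
      using continuous_measurable[OF continuous_on_mult[OF kc(1) continuous_on_cnj[OF k]]]
      by (rule integral_shift[symmetric, of "\<lambda>y. k (y + (b - a)) * cnj (k y)"])
    finally show ?thesis by (simp add: add.commute add.left_commute)
  qed
  have int: "integrable M (\<lambda>y. \<eta> a * cnj (\<eta> b) * (k (y + b) * cnj (k (y + a))))" for a b
    by (intro integrable_continuous continuous_intros kc)
  have "of_nat (card K) * isotypic K \<eta> ?h 0 = (\<Sum>b\<in>K. \<Sum>a\<in>K. \<eta> a * ?h (- a))"
    by (simp add: isotypic_def)
  also have "\<dots> = (\<Sum>b\<in>K. \<Sum>a\<in>K. \<eta> (a - b) * ?h (b - a))"
  proof (rule sum.cong[OF refl])
    fix b assume "b \<in> K"
    from finite_subgroup_sum_shift[OF K finite_subgroup_minus[OF K this], of "\<lambda>a. \<eta> a * ?h (- a)"]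
    show "(\<Sum>a\<in>K. \<eta> a * ?h (- a)) = (\<Sum>a\<in>K. \<eta> (a - b) * ?h (b - a))" by simp
  qed
  also have "\<dots> = (\<Sum>b\<in>K. \<Sum>a\<in>K. LINT y|M. \<eta> a * cnj (\<eta> b) * (k (y + b) * cnj (k (y + a))))"
    by (simp add: h dual_diff[OF \<eta>])
  also have "\<dots> = (LINT y|M. (\<Sum>b\<in>K. \<Sum>a\<in>K. \<eta> a * cnj (\<eta> b) * (k (y + b) * cnj (k (y + a)))))"
    by (simp add: Bochner_Integration.integral_sum Bochner_Integration.integrable_sum int)
  also have "\<dots> = (LINT y|M. of_real ((norm (isotypic K \<eta> (\<lambda>x. cnj (k (- x))) (- y)))\<^sup>2))"
  proof (rule Bochner_Integration.integral_cong[OF refl])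
    fix y
    have "of_real ((norm (isotypic K \<eta> (\<lambda>x. cnj (k (- x))) (- y)))\<^sup>2) =
        (\<Sum>a\<in>K. \<eta> a * cnj (k (y + a))) * (\<Sum>b\<in>K. cnj (\<eta> b) * k (y + b))"
      unfolding complex_norm_square by (simp add: isotypic_def algebra_simps)
    also have "\<dots> = (\<Sum>b\<in>K. \<Sum>a\<in>K. \<eta> a * cnj (\<eta> b) * (k (y + b) * cnj (k (y + a))))"
      unfolding sum_product by (subst sum.swap) (simp add: algebra_simps)
    finally show "(\<Sum>b\<in>K. \<Sum>a\<in>K. \<eta> a * cnj (\<eta> b) * (k (y + b) * cnj (k (y + a)))) =
      of_real ((norm (isotypic K \<eta> (\<lambda>x. cnj (k (- x))) (- y)))\<^sup>2)" ..
  qed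
  finally show ?thesis unfolding integral_complex_of_real .
qed

lemma autocorrelation_positive:
  fixes K :: "nat \<Rightarrow> 'a set"
  assumes "\<And>n. K n \<subseteq> K (Suc n)" "closure (\<Union>n. K n) = UNIV"
    and k: "continuous_on UNIV k" "k x0 \<noteq> 0"
  obtains r where "r > 0" "correlation M k (\<lambda>x. cnj (k x)) 0 = of_real r"
proof
  let ?F = "\<lambda>x. (norm (k x))\<^sup>2"
  have F: "continuous_on UNIV ?F" by (intro continuous_intros k)
  have int: "integrable M (\<lambda>x. ?F (x - t))" for t
  proof -
    have "integrable M ?F"
      using integrable_continuous[OF continuous_on_mult[OF k(1) continuous_on_cnj[OF k(1)]]]
      unfolding complex_norm_square[symmetric] complex_of_real_integrable_eq .
    from integrable_shift[OF this, of "- t"] show ?thesis by simp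
  qed
  have "?F x0 > 0" using k(2) by simp
  from translates_lower_bound[OF assms(1,2) F zero_le_power2 this]
  obtain T \<epsilon> where T: "finite T" "\<epsilon> > 0" "\<forall>x. (\<Sum>t\<in>T. ?F (x - t)) \<ge> \<epsilon>"
    by (elim exE conjE)
  have "\<epsilon> = (LINT x|M. \<epsilon>)" by simp
  also have "\<dots> \<le> (LINT x|M. (\<Sum>t\<in>T. ?F (x - t)))"
    using T(3) by (intro integral_mono Bochner_Integration.integrable_sum int) auto
  also have "\<dots> = (\<Sum>t\<in>T. LINT x|M. ?F (x - t))"
    by (intro Bochner_Integration.integral_sum int)
  also have "\<dots> = real (card T) * (LINT x|M. ?F x)"
    using integral_shift[OF continuous_measurable[OF F], of "- _"] by simp
  finally show "(LINT x|M. ?F x) > 0"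
    using T(2) by (smt (verit) mult_nonneg_nonpos of_nat_0_le_iff)
  show "correlation M k (\<lambda>x. cnj (k x)) 0 = of_real (LINT x|M. ?F x)"
    by (simp add: correlation_def complex_norm_square[symmetric] del: of_real_power)
qed

text \<open>
  With \<open>c\<^sub>\<eta> = isotypic (K n) \<eta> h 0 / card (K n)\<close>, the \<open>c\<^sub>\<eta>\<close> are nonnegative with sum \<open>h 0\<close>, while
  the sum of their squares is the mean of \<open>\<bar>h\<bar>\<^sup>2\<close> over \<open>K n\<close>. The latter is at least a constant
  \<open>\<theta> > 0\<close> and at most \<open>h 0\<close> times the largest \<open>c\<^sub>\<eta>\<close>.
\<close>
lemma large_coefficient:
  fixes K :: "nat \<Rightarrow> 'a set"
  assumes mono: "\<And>n. K n \<subseteq> K (Suc n)" and dense: "closure (\<Union>n. K n) = UNIV"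
    and K: "\<And>n. finite_subgroup (K n)" and D: "\<And>n. complete_characters (K n) (D n)"
    and k: "continuous_on UNIV k" "k x0 \<noteq> 0"
  defines "h \<equiv> correlation M k (\<lambda>x. cnj (k x))"
  shows "\<exists>\<delta>>0. \<exists>N. \<forall>n\<ge>N. \<exists>\<eta>\<in>D n. norm (isotypic (K n) \<eta> h 0) \<ge> \<delta> * real (card (K n))"
proof -
  obtain r where r: "r > 0" "h 0 = of_real r"
    using autocorrelation_positive[OF mono dense k] unfolding h_def by metis
  let ?F = "\<lambda>x. (norm (h x))\<^sup>2"
  have "continuous_on UNIV h"
    unfolding h_def by (intro correlation_continuous integrable_continuous continuous_intros k)
  then have F: "continuous_on UNIV ?F" by (intro continuous_intros)
  have F0: "?F 0 > 0" using r by simp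
  from translates_lower_bound[OF mono dense F zero_le_power2 F0]
  obtain T N \<epsilon> where T: "finite T" "\<forall>n\<ge>N. T \<subseteq> K n" "\<epsilon> > 0" "\<forall>x. (\<Sum>t\<in>T. ?F (x - t)) \<ge> \<epsilon>"
    by (elim exE conjE)
  have "card T > 0" using T by (cases "T = {}") (auto simp: card_gt_0_iff)
  \<comment> \<open>The factor 2 in \<open>\<delta>\<close> makes the final contradiction strict.\<close>
  define \<theta> where "\<theta> = \<epsilon> / real (card T)"
  have "\<theta> > 0" using T(3) \<open>card T > 0\<close> by (simp add: \<theta>_def)
  define \<delta> where "\<delta> = \<theta> / (2 * r)"
  have "\<delta> > 0" using \<open>\<theta> > 0\<close> r by (simp add: \<delta>_def)
  moreover have "\<exists>\<eta>\<in>D n. norm (isotypic (K n) \<eta> h 0) \<ge> \<delta> * real (card (K n))" if n: "n \<ge> N" for n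
  proof (rule ccontr)
    let ?c = "\<lambda>\<eta>. isotypic (K n) \<eta> h 0" and ?q = "real (card (K n))"
    assume "\<not> (\<exists>\<eta>\<in>D n. norm (?c \<eta>) \<ge> \<delta> * ?q)"
    then have small: "norm (?c \<eta>) \<le> \<delta> * ?q" if "\<eta> \<in> D n" for \<eta> using that by fastforce
    have q: "?q > 0" using finite_subgroup_card[OF K] by simp
    have dual: "\<eta> \<in> dual_group" if "\<eta> \<in> D n" for \<eta> using D[of n] that by (auto simp: complete_characters_def)
    have nonneg: "?c \<eta> = of_real (norm (?c \<eta>))" if "\<eta> \<in> D n" for \<eta>
    proof -
      define I where "I = (LINT y|M. (norm (isotypic (K n) \<eta> (\<lambda>x. cnj (k (- x))) (- y)))\<^sup>2)"
      have "I \<ge> 0" unfolding I_def by (intro Bochner_Integration.integral_nonneg) simp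
      have "of_nat (card (K n)) * ?c \<eta> = of_real I"
        unfolding h_def I_def by (rule autocorrelation_coefficient[OF k(1) K dual[OF that]])
      then have "?c \<eta> = of_real (I / ?q)"
        using q by (simp add: field_simps)
      then show ?thesis using \<open>I \<ge> 0\<close> by (simp add: norm_divide)
    qed
    have "(\<Sum>\<eta>\<in>D n. ?c \<eta>) = of_nat (card (K n)) * h 0"
      using isotypic_inversion[OF K D finite_subgroup_zero[OF K], of n h 0]
      by (simp add: dual_zero dual)
    moreover have "(\<Sum>\<eta>\<in>D n. ?c \<eta>) = (\<Sum>\<eta>\<in>D n. of_real (norm (?c \<eta>)))"
      using nonneg by (intro sum.cong refl)
    ultimately have "complex_of_real (\<Sum>\<eta>\<in>D n. norm (?c \<eta>)) = of_real (?q * r)"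
      using r by simp
    then have sum1: "(\<Sum>\<eta>\<in>D n. norm (?c \<eta>)) = ?q * r"
      unfolding of_real_eq_iff .
    have "?q * \<epsilon> = (\<Sum>a\<in>K n. \<epsilon>)" by simp
    also have "\<dots> \<le> (\<Sum>a\<in>K n. \<Sum>t\<in>T. ?F (a - t))"
      using T(4) by (intro sum_mono) simp
    also have "\<dots> = (\<Sum>t\<in>T. \<Sum>a\<in>K n. ?F (a + (- t)))"
      by (subst sum.swap) simp
    also have "\<dots> = (\<Sum>t\<in>T. \<Sum>a\<in>K n. ?F a)"
      using T(2) n finite_subgroup_minus[OF K] by (intro sum.cong refl finite_subgroup_sum_shift K) auto
    also have "\<dots> = real (card T) * (\<Sum>a\<in>K n. ?F a)" by simp
    finally have "?q * \<theta> \<le> (\<Sum>a\<in>K n. ?F a)"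
      using \<open>card T > 0\<close> by (simp add: \<theta>_def field_simps)
    then have "?q * (?q * \<theta>) \<le> ?q * (\<Sum>a\<in>K n. ?F a)"
      by (intro mult_left_mono) auto
    also have "\<dots> = ?q * (\<Sum>a\<in>K n. ?F (0 - a))"
      using finite_subgroup_sum_minus[OF K, of ?F n] by simp
    also have "\<dots> = (\<Sum>\<eta>\<in>D n. (norm (?c \<eta>))\<^sup>2)"
      by (rule isotypic_parseval[OF K D, symmetric])
    also have "\<dots> \<le> (\<Sum>\<eta>\<in>D n. \<delta> * ?q * norm (?c \<eta>))"
      unfolding power2_eq_square by (intro sum_mono mult_right_mono small) auto
    also have "\<dots> = \<delta> * ?q * (?q * r)"
      by (simp add: sum_distrib_left[symmetric] sum1)
    finally have "?q * ?q * (\<theta>) \<le> ?q * ?q * (\<delta> * r)" by (simp add: mult_ac)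
    then have "\<theta> \<le> \<delta> * r"
      by (rule mult_left_le_imp_le) (rule mult_pos_pos[OF q q])
    moreover have "\<delta> * r = \<theta> / 2" using r(1) by (simp add: \<delta>_def)
    ultimately show False using \<open>\<theta> > 0\<close> by linarith
  qed
  ultimately show ?thesis by blast
qed

lemma fourier_isotypic:
  assumes f: "integrable M f" and \<xi>: "\<xi> \<in> dual_group"
  shows "fourier M (isotypic K \<eta> f) \<xi> = (\<Sum>a\<in>K. \<eta> a * cnj (\<xi> a)) * fourier M f \<xi>"
proof -
  have c: "continuous_on UNIV (\<lambda>x. cnj (\<xi> x))"
    by (intro continuous_on_cnj dual_continuous \<xi>)
  have int: "integrable M (\<lambda>x. \<eta> a * (f (x - a) * cnj (\<xi> x)))" for a
    using integrable_mult_continuous[OF integrable_shift[OF f, of "- a"] c] by simp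
  have "fourier M (isotypic K \<eta> f) \<xi> = (LINT x|M. (\<Sum>a\<in>K. \<eta> a * (f (x - a) * cnj (\<xi> x))))"
    by (simp add: fourier_def isotypic_def sum_distrib_right mult.assoc)
  also have "\<dots> = (\<Sum>a\<in>K. LINT x|M. \<eta> a * (f (x - a) * cnj (\<xi> x)))"
    by (intro Bochner_Integration.integral_sum int)
  also have "\<dots> = (\<Sum>a\<in>K. \<eta> a * cnj (\<xi> a) * fourier M f \<xi>)"
  proof (rule sum.cong[OF refl])
    fix a
    have "(\<lambda>x. \<eta> a * (f (x - a) * cnj (\<xi> x))) =
        (\<lambda>x. \<eta> a * cnj (\<xi> a) * (f (x - a) * cnj (\<xi> (x - a))))"
    proof
      fix x
      show "\<eta> a * (f (x - a) * cnj (\<xi> x)) = \<eta> a * cnj (\<xi> a) * (f (x - a) * cnj (\<xi> (x - a)))"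
        using dual_add[OF \<xi>, of "x - a" a] by simp
    qed
    then have "(LINT x|M. \<eta> a * (f (x - a) * cnj (\<xi> x))) =
        \<eta> a * cnj (\<xi> a) * (LINT x|M. f (x - a) * cnj (\<xi> (x - a)))"
      by simp
    also have "(LINT x|M. f (x - a) * cnj (\<xi> (x - a))) = fourier M f \<xi>"
      using integral_shift[of "\<lambda>x. f x * cnj (\<xi> x)" "- a"] integrable_mult_continuous[OF f c]
      by (simp add: fourier_def)
    finally show "(LINT x|M. \<eta> a * (f (x - a) * cnj (\<xi> x))) = \<eta> a * cnj (\<xi> a) * fourier M f \<xi>" .
  qed
  finally show ?thesis by (simp add: sum_distrib_right)
qed

text \<open>
  If \<open>f\<close> is not zero then some correlation \<open>k\<close> with a continuous function is not zero, and neither is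
  the autocorrelation \<open>h\<close> of \<open>k\<close>; all transforms still vanish. The normalised isotypic
  parts \<open>p n\<close> of \<open>h\<close> for characters with a large coefficient inherit a bound and a modulus of
  continuity from \<open>h\<close>, so a subsequence converges, first on the countable dense subgroup and then
  everywhere. The limit \<open>q\<close> satisfies \<open>q (x + b) * q 0 = q x * q b\<close>, hence is a nonzero multiple of a
  character, whose transform at that character does not vanish.
\<close>
theorem fourier_uniqueness:
  fixes K :: "nat \<Rightarrow> 'a set"
  assumes mono: "\<And>n. K n \<subseteq> K (Suc n)" and dense: "closure (\<Union>n. K n) = UNIV"
    and K: "\<And>n. finite_subgroup (K n)" and D: "\<And>n. complete_characters (K n) (D n)"
    and f: "integrable M f" and zero: "\<And>\<xi>. \<xi> \<in> dual_group \<Longrightarrow> fourier M f \<xi> = 0"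
  shows "AE x in M. f x = 0"
proof (rule ccontr)
  assume "\<not> (AE x in M. f x = 0)"
  then obtain g where g: "continuous_on UNIV g" "(LINT x|M. f x * g x) \<noteq> 0"
    using AE_zero_if_continuous_integrals_zero[OF f] by blast
  define k where "k = correlation M f g"
  have k: "continuous_on UNIV k" unfolding k_def by (rule correlation_continuous[OF f g(1)])
  have k0: "k 0 \<noteq> 0" using g(2) by (simp add: k_def correlation_def)
  define h where "h = correlation M k (\<lambda>x. cnj (k x))"
  have h: "continuous_on UNIV h"
    unfolding h_def by (intro correlation_continuous integrable_continuous continuous_intros k)
  have h_zero: "fourier M h \<xi> = 0" if "\<xi> \<in> dual_group" for \<xi>
    unfolding h_def
  proof (rule fourier_correlation_zero[OF integrable_continuous[OF k] continuous_on_cnj[OF k] that])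
    show "fourier M k \<xi> = 0"
      unfolding k_def by (rule fourier_correlation_zero[OF f g(1) that zero[OF that]])
  qed
  obtain C where C: "C > 0" "\<And>x. norm (h x) \<le> C" using continuous_bounded[OF h] by blast
  obtain \<delta> N where \<delta>: "\<delta> > 0"
    "\<forall>n\<ge>N. \<exists>\<eta>\<in>D n. norm (isotypic (K n) \<eta> h 0) \<ge> \<delta> * real (card (K n))"
    using large_coefficient[OF mono dense K D k k0, folded h_def] by (elim exE conjE)
  \<comment> \<open>Large coefficients exist from level \<open>N\<close> on, so the sequence starts there.\<close>
  define L where "L n = K (N + n)" for n
  have L: "finite_subgroup (L n)" for n unfolding L_def by (rule K)
  have card_L: "real (card (L n)) > 0" for n using finite_subgroup_card[OF L] by simp
  have "\<exists>\<eta>\<in>dual_group. norm (isotypic (L n) \<eta> h 0) \<ge> \<delta> * real (card (L n))" for n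
    using \<delta>(2)[rule_format, of "N + n"] D[of "N + n"] by (auto simp: L_def complete_characters_def)
  then obtain \<eta> where \<eta>: "\<And>n. \<eta> n \<in> dual_group"
    "\<And>n. norm (isotypic (L n) (\<eta> n) h 0) \<ge> \<delta> * real (card (L n))" by metis
  define p where "p n x = isotypic (L n) (\<eta> n) h x / of_nat (card (L n))" for n x
  have p_bound: "norm (p n x) \<le> C" for n x
    using norm_character_sum_le[OF L \<eta>(1), of "\<lambda>a. h (x - a)" C n n] C(2) card_L[of n]
    by (simp add: p_def isotypic_def norm_divide field_simps)
  have p_equi: "norm (p n (x + u) - p n x) \<le> \<epsilon>" if "\<And>x. norm (h (x + u) - h x) \<le> \<epsilon>" for n x u \<epsilon>
  proof -
    have "norm (\<Sum>a\<in>L n. \<eta> n a * (h (x - a + u) - h (x - a))) \<le> real (card (L n)) * \<epsilon>"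
      by (rule norm_character_sum_le[OF L \<eta>(1)]) (rule that)
    moreover have "p n (x + u) - p n x =
        (\<Sum>a\<in>L n. \<eta> n a * (h (x - a + u) - h (x - a))) / of_nat (card (L n))"
      by (simp add: p_def isotypic_def diff_divide_distrib sum_subtractf algebra_simps)
    ultimately show ?thesis
      using card_L[of n] by (simp only: norm_divide norm_of_nat pos_divide_le_eq mult.commute)
  qed
  have p_0: "norm (p n 0) \<ge> \<delta>" for n
    using \<eta>(2)[of n] card_L[of n] by (simp add: p_def norm_divide field_simps)
  have p_shift: "p n (x + b) = \<eta> n b * p n x" if "b \<in> L n" for n x b
    using isotypic_shift[OF L \<eta>(1) finite_subgroup_minus[OF L that], of n h x]
    by (simp add: p_def dual_minus[OF \<eta>(1)])
  have p_cont: "continuous_on UNIV (p n)" for n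
    unfolding p_def isotypic_def using card_L[of n]
    by (intro continuous_intros continuous_on_compose2[OF h]) auto
  have p_zero: "fourier M (p n) \<xi> = 0" if "\<xi> \<in> dual_group" for n \<xi>
    using fourier_isotypic[OF integrable_continuous[OF h] that] h_zero[OF that]
    by (simp add: p_def fourier_def)
  let ?S = "\<Union>n. K n"
  have "countable ?S" using finite_subgroup_finite[OF K] by (auto intro: countable_finite)
  then obtain s where s: "strict_mono s" "\<And>x. x \<in> ?S \<Longrightarrow> \<exists>l. (\<lambda>n. p (s n) x) \<longlonglongrightarrow> l"
    using function_convergent_subsequence[of ?S p C] p_bound by blast
  have "convergent (\<lambda>n. p (s n) x)" for x
    unfolding Cauchy_convergent_iff[symmetric]
  proof (rule metric_CauchyI)
    fix e :: real assume "e > 0"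
    then obtain U where U: "open U" "0 \<in> U" "\<And>u x. u \<in> U \<Longrightarrow> norm (h (x + u) - h x) < e / 4"
      using uniformly_continuous_translation[OF compact_UNIV h, of "e / 4"] by auto
    \<comment> \<open>A point \<open>b\<close> of the dense subgroup close to \<open>x\<close>: there the sequence converges, and equicontinuity transfers the Cauchy property to \<open>x\<close>.\<close>
    have "open ((\<lambda>b. x - b) -` U)" by (intro open_vimage U continuous_intros)
    moreover have "x \<in> (\<lambda>b. x - b) -` U" using U by simp
    ultimately obtain b where b: "b \<in> ?S" "x - b \<in> U"
      using dense open_Int_closure_eq_empty[of "(\<lambda>b. x - b) -` U" ?S] by blast
    then have "Cauchy (\<lambda>n. p (s n) b)"
      using s(2) by (auto intro: convergentI simp: Cauchy_convergent_iff)
    then obtain n0 where n0: "\<And>m n. m \<ge> n0 \<Longrightarrow> n \<ge> n0 \<Longrightarrow> dist (p (s m) b) (p (s n) b) < e / 4"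
      using \<open>e > 0\<close> metric_CauchyD[of _ "e / 4"] by (metis divide_pos_pos zero_less_numeral)
    have near: "dist (p n x) (p n b) \<le> e / 4" for n
      using p_equi[of "x - b" "e / 4" n b] U(3)[OF b(2)] by (auto simp: dist_norm less_imp_le)
    have "dist (p (s m) x) (p (s n) x) < e" if "m \<ge> n0" "n \<ge> n0" for m n
    proof -
      have "dist (p (s m) x) (p (s n) x) \<le> dist (p (s m) x) (p (s m) b) + dist (p (s m) b) (p (s n) b)
          + dist (p (s n) x) (p (s n) b)"
        using dist_triangle[of "p (s m) x" "p (s n) x" "p (s m) b"]
          dist_triangle[of "p (s m) b" "p (s n) x" "p (s n) b"]
          dist_commute[of "p (s n) b" "p (s n) x"] by linarith
      with near[of "s m"] near[of "s n"] n0[OF that] \<open>e > 0\<close> show ?thesis by linarith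
    qed
    then show "\<exists>M. \<forall>m\<ge>M. \<forall>n\<ge>M. dist (p (s m) x) (p (s n) x) < e" by blast
  qed
  then obtain q where q: "\<And>x. (\<lambda>n. p (s n) x) \<longlonglongrightarrow> q x"
    unfolding convergent_def by metis
  have q_cont: "continuous_on UNIV q"
  proof (rule continuous_if_equicontinuous)
    fix \<epsilon> :: real assume "\<epsilon> > 0"
    then obtain U where U: "open U" "0 \<in> U" "\<And>u x. u \<in> U \<Longrightarrow> norm (h (x + u) - h x) < \<epsilon>"
      using uniformly_continuous_translation[OF compact_UNIV h, of \<epsilon>] by auto
    have "norm (q (x + u) - q x) \<le> \<epsilon>" if "u \<in> U" for u x
    proof (rule LIMSEQ_le_const2)
      show "(\<lambda>n. norm (p (s n) (x + u) - p (s n) x)) \<longlonglongrightarrow> norm (q (x + u) - q x)"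
        by (intro tendsto_intros q)
      show "\<exists>N. \<forall>n\<ge>N. norm (p (s n) (x + u) - p (s n) x) \<le> \<epsilon>"
        using p_equi U(3)[OF that] by (meson less_imp_le)
    qed
    then show "\<exists>U. open U \<and> 0 \<in> U \<and> (\<forall>u\<in>U. \<forall>x. norm (q (x + u) - q x) \<le> \<epsilon>)"
      using U by blast
  qed
  have q_0: "norm (q 0) \<ge> \<delta>"
    by (rule LIMSEQ_le_const[OF tendsto_norm[OF q]]) (use p_0 in auto)
  \<comment> \<open>The functional equation of \<open>p n\<close> holds for translations in \<open>L n\<close> only; a given element of the dense subgroup lies in almost all of these groups.\<close>
  have ev: "eventually (\<lambda>n. b \<in> L (s n)) sequentially" if b: "b \<in> ?S" for b
  proof -
    obtain i where i: "b \<in> K i" using b by auto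
    have "b \<in> L (s n)" if "n \<ge> i" for n
      using lift_Suc_mono_le[where f = K, OF mono, of i "N + s n"] i that seq_suble[OF s(1), of n]
      by (auto simp: L_def)
    then show ?thesis unfolding eventually_sequentially by blast
  qed
  have q_mult: "q (x + b) * q 0 = q x * q b" for x b
  proof (rule continuous_eq_on_dense[OF dense, of "\<lambda>b. q (x + b) * q 0" "\<lambda>b. q x * q b"])
    fix b assume "b \<in> ?S"
    have "eventually (\<lambda>n. p (s n) (x + b) * p (s n) 0 = p (s n) x * p (s n) b) sequentially"
      using ev[OF \<open>b \<in> ?S\<close>]
    proof eventually_elim
      case (elim n)
      then show ?case using p_shift[of b "s n" x] p_shift[of b "s n" 0] by simp
    qed
    moreover have "(\<lambda>n. p (s n) (x + b) * p (s n) 0) \<longlonglongrightarrow> q (x + b) * q 0"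
      by (intro tendsto_intros q)
    ultimately have "(\<lambda>n. p (s n) x * p (s n) b) \<longlonglongrightarrow> q (x + b) * q 0"
      by (rule Lim_transform_eventually[rotated])
    moreover have "(\<lambda>n. p (s n) x * p (s n) b) \<longlonglongrightarrow> q x * q b"
      by (intro tendsto_intros q)
    ultimately show "q (x + b) * q 0 = q x * q b" by (rule LIMSEQ_unique)
  qed (intro continuous_intros continuous_on_compose2[OF q_cont] subset_UNIV)+
  have q_norm: "norm (q b) = norm (q 0)" for b
  proof -
    have "complex_of_real (norm (q b)) = of_real (norm (q 0))"
    proof (rule continuous_eq_on_dense[OF dense, of "\<lambda>b. complex_of_real (norm (q b))"])
      fix b assume "b \<in> ?S"
      have "eventually (\<lambda>n. norm (p (s n) b) = norm (p (s n) 0)) sequentially"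
        using ev[OF \<open>b \<in> ?S\<close>]
      proof eventually_elim
        case (elim n)
        then show ?case using p_shift[of b "s n" 0] by (simp add: norm_mult dual_norm[OF \<eta>(1)])
      qed
      then have "(\<lambda>n. norm (p (s n) 0)) \<longlonglongrightarrow> norm (q b)"
        by (rule Lim_transform_eventually[OF tendsto_norm[OF q]])
      then show "complex_of_real (norm (q b)) = of_real (norm (q 0))"
        using LIMSEQ_unique tendsto_norm[OF q] by metis
    qed (intro continuous_intros q_cont)+
    then show ?thesis by simp
  qed
  have q0: "q 0 \<noteq> 0" using q_0 \<delta>(1) by auto
  define \<xi> where "\<xi> x = q x / q 0" for x
  have \<xi>: "\<xi> \<in> dual_group"
    unfolding dual_group_def
  proof (intro CollectI conjI allI)
    show "continuous_on UNIV \<xi>" unfolding \<xi>_def by (intro continuous_intros q_cont) (use q0 in auto)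
    show "norm (\<xi> x) = 1" for x using q0 q_norm[of x] by (simp add: \<xi>_def norm_divide)
    show "\<xi> (x + y) = \<xi> x * \<xi> y" for x y using q0 q_mult[of x y] by (simp add: \<xi>_def field_simps)
  qed
  have \<xi>m: "(\<lambda>x. cnj (\<xi> x)) \<in> borel_measurable M"
    by (intro continuous_measurable continuous_on_cnj dual_continuous \<xi>)
  have "(\<lambda>n. fourier M (p (s n)) \<xi>) \<longlonglongrightarrow> fourier M q \<xi>"
    unfolding fourier_def
  proof (rule integral_dominated_convergence[where w = "\<lambda>x. C"])
    show "(\<lambda>x. q x * cnj (\<xi> x)) \<in> borel_measurable M" "(\<lambda>x. p (s n) x * cnj (\<xi> x)) \<in> borel_measurable M" for n
      by (intro borel_measurable_times \<xi>m continuous_measurable q_cont p_cont)+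
    show "AE x in M. (\<lambda>n. p (s n) x * cnj (\<xi> x)) \<longlonglongrightarrow> q x * cnj (\<xi> x)"
      by (intro AE_I2 tendsto_intros q)
    show "AE x in M. norm (p (s n) x * cnj (\<xi> x)) \<le> C" for n
      using p_bound by (intro AE_I2) (simp add: norm_mult dual_norm[OF \<xi>])
  qed simp
  then have "fourier M q \<xi> = 0" using p_zero[OF \<xi>] by (simp add: LIMSEQ_const_iff)
  moreover have "q x * cnj (\<xi> x) = q 0" for x
    using dual_cnj_mult[OF \<xi>, of x] q0 by (simp add: \<xi>_def field_simps)
  then have "fourier M q \<xi> = q 0" by (simp add: fourier_def)
  ultimately show False using q0 by simp
qed

end

section \<open>Orthogonality and completeness of characters\<close>

lemma character_orthogonality:
  assumes K: "finite_subgroup K" and \<eta>: "\<eta> \<in> dual_group" and \<xi>: "\<xi> \<in> dual_group"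
  shows "(\<Sum>a\<in>K. \<eta> a * cnj (\<xi> a)) = (if \<forall>a\<in>K. \<eta> a = \<xi> a then of_nat (card K) else 0)"
proof (cases "\<forall>a\<in>K. \<eta> a = \<xi> a")
  case True
  then show ?thesis by (simp add: dual_cnj_mult[OF \<xi>])
next
  case False
  then obtain b where b: "b \<in> K" "\<eta> b \<noteq> \<xi> b" by auto
  let ?S = "\<Sum>a\<in>K. \<eta> a * cnj (\<xi> a)"
  have "\<eta> b * cnj (\<xi> b) * ?S = (\<Sum>a\<in>K. \<eta> (a + b) * cnj (\<xi> (a + b)))"
    by (simp add: sum_distrib_left dual_add[OF \<eta>] dual_add[OF \<xi>] algebra_simps)
  also have "\<dots> = ?S" by (rule finite_subgroup_sum_shift[OF K b(1)])
  finally have "\<eta> b * cnj (\<xi> b) = 1 \<or> ?S = 0" by auto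
  moreover have "\<eta> b * cnj (\<xi> b) \<noteq> 1"
  proof
    assume "\<eta> b * cnj (\<xi> b) = 1"
    then have "\<eta> b * cnj (\<xi> b) * \<xi> b = \<xi> b" by simp
    then show False
      using b(2) dual_cnj_mult[OF \<xi>, of b] by (simp add: mult.assoc mult.commute[of "cnj _"])
  qed
  ultimately have "?S = 0" by blast
  then show ?thesis using False by (simp only: if_False)
qed

text \<open>
  Let \<open>F\<close> be the sum of the characters in \<open>D\<close>. By orthogonality the sum of \<open>\<bar>F a\<bar>\<^sup>2\<close> over \<open>K\<close> is
  \<open>card D * card K\<close>. Since \<open>card D = card K\<close> this is the contribution \<open>(card D)\<^sup>2\<close> of \<open>a = 0\<close> alone, so
  \<open>F\<close> vanishes elsewhere.
\<close>
lemma complete_charactersI: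
  assumes K: "finite_subgroup K" and D: "finite D" "D \<subseteq> dual_group" "card D = card K"
    and separated: "\<And>\<eta> \<xi>. \<eta> \<in> D \<Longrightarrow> \<xi> \<in> D \<Longrightarrow> \<forall>a\<in>K. \<eta> a = \<xi> a \<Longrightarrow> \<eta> = \<xi>"
  shows "complete_characters K D"
proof -
  define F where "F a = (\<Sum>\<eta>\<in>D. \<eta> a)" for a
  have F0: "F 0 = of_nat (card K)"
    using D by (auto simp: F_def dual_zero subset_iff)
  have "complex_of_real (\<Sum>a\<in>K. (norm (F a))\<^sup>2) = (\<Sum>a\<in>K. \<Sum>\<eta>\<in>D. \<Sum>\<xi>\<in>D. \<eta> a * cnj (\<xi> a))"
    unfolding of_real_sum complex_norm_square by (simp add: F_def sum_product)
  also have "\<dots> = (\<Sum>\<eta>\<in>D. \<Sum>\<xi>\<in>D. \<Sum>a\<in>K. \<eta> a * cnj (\<xi> a))"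
    by (subst sum.swap, intro sum.cong refl, rule sum.swap)
  also have "\<dots> = (\<Sum>\<eta>\<in>D. \<Sum>\<xi>\<in>D. if \<xi> = \<eta> then of_nat (card K) else 0)"
    using D(2) separated by (intro sum.cong refl) (auto simp: character_orthogonality[OF K] subset_iff)
  also have "\<dots> = of_real (real (card K) * real (card K))"
    using D by (simp add: sum.delta)
  finally have "(\<Sum>a\<in>K. (norm (F a))\<^sup>2) = (norm (F 0))\<^sup>2"
    unfolding of_real_eq_iff by (simp add: F0 power2_eq_square)
  then have "(\<Sum>a\<in>K - {0}. (norm (F a))\<^sup>2) = 0"
    using finite_subgroup_finite[OF K] finite_subgroup_zero[OF K] by (simp add: sum.remove)
  then have "F a = 0" if "a \<in> K" "a \<noteq> 0" for a
    using that finite_subgroup_finite[OF K] by (simp add: sum_nonneg_eq_0_iff)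
  then show ?thesis using D F0 by (auto simp: complete_characters_def F_def)
qed

text \<open>
  If \<open>\<xi>\<close> differed on \<open>K\<close> from every character in \<open>D\<close> it would be orthogonal to all of them, which
  contradicts inversion at \<open>0\<close>.
\<close>
lemma complete_characters_representative:
  assumes K: "finite_subgroup K" and D: "complete_characters K D" and \<xi>: "\<xi> \<in> dual_group"
  obtains \<eta> where "\<eta> \<in> D" "\<And>a. a \<in> K \<Longrightarrow> \<xi> a = \<eta> a"
proof -
  have "(\<Sum>\<eta>\<in>D. \<Sum>a\<in>K. \<eta> a * cnj (\<xi> a)) = (\<Sum>a\<in>K. (\<Sum>\<eta>\<in>D. \<eta> a) * cnj (\<xi> a))"
    by (subst sum.swap) (simp add: sum_distrib_right)
  also have "\<dots> = (\<Sum>a\<in>K. if a = 0 then of_nat (card K) else 0)"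
    using D by (intro sum.cong refl) (auto simp: complete_characters_def dual_zero[OF \<xi>])
  also have "\<dots> \<noteq> 0"
    using finite_subgroup_finite[OF K] finite_subgroup_zero[OF K] by (auto simp: sum.delta)
  finally obtain \<eta> where \<eta>: "\<eta> \<in> D" "(\<Sum>a\<in>K. \<eta> a * cnj (\<xi> a)) \<noteq> 0"
    by (metis (no_types, lifting) sum.neutral)
  then have "\<eta> \<in> dual_group" using D by (auto simp: complete_characters_def)
  with \<eta> have "\<forall>a\<in>K. \<eta> a = \<xi> a"
    using character_orthogonality[OF K _ \<xi>] by metis
  then show ?thesis using that[OF \<eta>(1)] by metis
qed

lemma dual_char_add: "\<xi> \<in> dual_group \<Longrightarrow> \<eta> \<in> dual_group \<Longrightarrow> \<xi> +\<^sub>c \<eta> \<in> dual_group"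
  by (auto simp: dual_group_def char_add_def norm_mult intro!: continuous_on_mult)

lemma char_coset_annihilator:
  assumes "\<eta> \<in> dual_group"
  shows "char_coset (annihilator H) \<eta> = {\<xi> \<in> dual_group. \<forall>h\<in>H. \<xi> h = \<eta> h}"
proof (intro subset_antisym subsetI)
  fix \<xi> assume "\<xi> \<in> char_coset (annihilator H) \<eta>"
  then show "\<xi> \<in> {\<xi> \<in> dual_group. \<forall>h\<in>H. \<xi> h = \<eta> h}"
    using dual_char_add[OF _ assms] by (auto simp: char_coset_def annihilator_def) (simp add: char_add_def)
next
  fix \<xi> assume "\<xi> \<in> {\<xi> \<in> dual_group. \<forall>h\<in>H. \<xi> h = \<eta> h}"
  then have \<xi>: "\<xi> \<in> dual_group" "\<And>h. h \<in> H \<Longrightarrow> \<xi> h = \<eta> h" by auto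
  have inv: "(\<lambda>x. cnj (\<eta> x)) \<in> dual_group"
    using assms by (auto simp: dual_group_def intro: continuous_on_cnj)
  have "\<xi> = (\<xi> +\<^sub>c (\<lambda>x. cnj (\<eta> x))) +\<^sub>c \<eta>"
    using dual_cnj_mult[OF assms] by (simp add: char_add_def fun_eq_iff mult.assoc mult.commute[of "cnj _"])
  moreover have "\<xi> +\<^sub>c (\<lambda>x. cnj (\<eta> x)) \<in> annihilator H"
    using dual_char_add[OF \<xi>(1) inv] \<xi>(2) dual_cnj_mult[OF assms] by (auto simp: annihilator_def char_add_def)
  ultimately show "\<xi> \<in> char_coset (annihilator H) \<eta>"
    unfolding char_coset_def by blast
qed

section \<open>Kernels of the powers of the dilation and digits\<close>

locale dilation =
  fixes A :: "'a::topological_ab_group_add \<Rightarrow> 'a" and m :: nat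
  assumes additive: "Modules.additive A" and surj: "surj A"
    and finite_ker: "finite (ker_pow A 1)"
    and m_def: "m = card (ker_pow A 1)"
begin

lemma pow_add: "(A ^^ j) (x + y) = (A ^^ j) x + (A ^^ j) y"
  by (induction j) (simp_all add: Modules.additive.add[OF additive])

lemma pow_zero: "(A ^^ j) 0 = 0"
  using pow_add[of j 0 0] by simp

lemma pow_diff: "(A ^^ j) (x - y) = (A ^^ j) x - (A ^^ j) y"
  using pow_add[of j "x - y" y] by (simp add: algebra_simps)

lemma pow_surj: "surj (A ^^ j)"
proof (induction j)
  case (Suc j)
  then show ?case unfolding funpow.simps by (rule comp_surj[OF _ surj])
qed simp

lemma ker_pow_mono: "ker_pow A j \<subseteq> ker_pow A (Suc j)"
  using pow_zero[of 1] by (auto simp: ker_pow_def)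

lemma ker_pow_one: "ker_pow A 1 = {x. A x = 0}"
  by (simp add: ker_pow_def)

text \<open>
  The kernel of \<open>A\<^sup>j\<^sup>+\<^sup>1\<close> is the preimage under \<open>A\<close> of the kernel of \<open>A\<^sup>j\<close>, and every fibre of \<open>A\<close> is a
  translate of \<open>ker A\<close>.
\<close>
lemma ker_pow_finite_card: "finite (ker_pow A j) \<and> card (ker_pow A j) = m ^ j"
proof (induction j)
  case 0
  have "ker_pow A 0 = {0}" by (auto simp: ker_pow_def)
  then show ?case by simp
next
  case (Suc j)
  have fiber: "finite (A -` {y}) \<and> card (A -` {y}) = m" for y
  proof -
    obtain x0 where x0: "A x0 = y" using surj by (metis surjD)
    have "A -` {y} = (\<lambda>a. a + x0) ` ker_pow A 1"
    proof (intro subset_antisym subsetI)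
      fix x assume "x \<in> A -` {y}"
      then have "x - x0 \<in> ker_pow A 1" using pow_diff[of 1 x x0] x0 unfolding ker_pow_one by simp
      then show "x \<in> (\<lambda>a. a + x0) ` ker_pow A 1" by (rule rev_image_eqI) simp
    next
      fix x assume "x \<in> (\<lambda>a. a + x0) ` ker_pow A 1"
      then show "x \<in> A -` {y}"
        using pow_add[of 1 _ x0] x0 unfolding ker_pow_one by auto
    qed
    moreover have "inj_on (\<lambda>a. a + x0) (ker_pow A 1)" by simp
    ultimately show ?thesis using finite_ker by (simp add: card_image m_def)
  qed
  have "ker_pow A (Suc j) = (\<Union>y\<in>ker_pow A j. A -` {y})"
    by (auto simp: ker_pow_def funpow_swap1)
  moreover have "card (\<Union>y\<in>ker_pow A j. A -` {y}) = (\<Sum>y\<in>ker_pow A j. card (A -` {y}))"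
    using Suc fiber by (intro card_UN_disjoint) auto
  ultimately show ?case using Suc fiber by simp
qed

lemma ker_pow_subgroup: "finite_subgroup (ker_pow A j)"
  using ker_pow_finite_card[of j] by (auto simp: finite_subgroup_def ker_pow_def pow_zero pow_diff)

lemma card_ker_pow: "card (ker_pow A j) = m ^ j"
  using ker_pow_finite_card by blast

lemma m_pos: "m > 0"
  using finite_subgroup_card[OF ker_pow_subgroup[of 1]] by (simp add: m_def)

end

lemma adjoint_hom_pow: "(adjoint_hom A ^^ j) \<xi> = (\<lambda>x. \<xi> ((A ^^ j) x))"
  by (induction j) (auto simp: adjoint_hom_def fun_eq_iff funpow_swap1)

lemma char_add_commute: "\<xi> +\<^sub>c \<eta> = \<eta> +\<^sub>c \<xi>"
  by (simp add: char_add_def fun_eq_iff mult.commute)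

locale dilation_digits = dilation A m for A :: "'a::topological_ab_group_add \<Rightarrow> 'a" and m +
  fixes \<pi> :: "nat \<Rightarrow> 'a \<Rightarrow> complex"
  assumes continuous: "continuous_on UNIV A" and digit: "digit_system A \<pi>"
begin

lemma pow_continuous: "continuous_on UNIV (A ^^ j)"
proof (induction j)
  case (Suc j)
  then show ?case using continuous_on_compose2[OF continuous Suc] by (simp add: comp_def)
qed (simp add: id_def)

lemma adjoint_digit_dual: "k < m \<Longrightarrow> (adjoint_hom A ^^ j) (\<pi> k) \<in> dual_group"
proof -
  assume "k < m"
  then have \<pi>: "\<pi> k \<in> dual_group" using digit by (simp add: digit_system_def m_def)
  then show ?thesis
    using continuous_on_compose2[OF dual_continuous[OF \<pi>] pow_continuous]
    by (auto simp: adjoint_hom_pow dual_group_def pow_add)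
qed

lemma digit_separated:
  assumes "k < m" "l < m" and "\<And>a. a \<in> ker_pow A 1 \<Longrightarrow> \<pi> k a = \<pi> l a"
  shows "k = l"
proof -
  have \<pi>: "\<pi> k \<in> dual_group" "\<pi> l \<in> dual_group"
    using digit assms(1,2) by (simp_all add: digit_system_def m_def)
  have "\<exists>!i. i < m \<and> \<pi> i \<in> char_coset (annihilator (ker_pow A 1)) (\<pi> k)"
    using digit \<pi>(1) unfolding digit_system_def m_def by blast
  moreover have "\<pi> k \<in> char_coset (annihilator (ker_pow A 1)) (\<pi> k)"
    "\<pi> l \<in> char_coset (annihilator (ker_pow A 1)) (\<pi> k)"
    using \<pi> assms(3) by (simp_all add: char_coset_annihilator)
  ultimately show ?thesis using assms(1,2) by blast
qed

abbreviation digit_char :: "nat \<Rightarrow> ('a \<Rightarrow> complex) \<Rightarrow> nat \<Rightarrow> 'a \<Rightarrow> complex" where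
  "digit_char j \<eta> k \<equiv> \<eta> +\<^sub>c (adjoint_hom A ^^ j) (\<pi> k)"

lemma digits_Suc_image: "digits A \<pi> (Suc j) = (\<lambda>(\<eta>, k). digit_char j \<eta> k) ` (digits A \<pi> j \<times> {..<m})"
  by (auto simp: m_def char_add_commute image_iff)

lemma digits_dual: "digits A \<pi> j \<subseteq> dual_group"
proof (induction j)
  case 0
  then show ?case by (auto simp: dual_group_def char_zero_def)
next
  case (Suc j)
  then show ?case unfolding digits_Suc_image by (auto intro!: dual_char_add adjoint_digit_dual)
qed

text \<open>
  The second summand of a digit is a character composed with \<open>A\<^sup>j\<close>, hence trivial on \<open>ker A\<^sup>j\<close>.
\<close>
lemma digit_char_ker: "k < m \<Longrightarrow> a \<in> ker_pow A j \<Longrightarrow> digit_char j \<eta> k a = \<eta> a"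
  using digit by (simp add: char_add_def adjoint_hom_pow ker_pow_def digit_system_def m_def dual_zero)

text \<open>
  \<open>A\<^sup>j\<close> maps \<open>ker A\<^sup>j\<^sup>+\<^sup>1\<close> onto \<open>ker A\<close>, where different \<open>\<pi> k\<close> differ.
\<close>
lemma digit_char_separated:
  assumes "\<xi> \<in> digits A \<pi> j" "k < m" "l < m"
    and agree: "\<forall>a\<in>ker_pow A (Suc j). digit_char j \<xi> k a = digit_char j \<xi> l a"
  shows "k = l"
proof (rule digit_separated[OF assms(2,3)])
  fix a assume a: "a \<in> ker_pow A 1"
  obtain x where x: "(A ^^ j) x = a" using pow_surj[of j] by (metis surjD)
  then have "x \<in> ker_pow A (Suc j)" using a by (simp add: ker_pow_def)
  then have "\<xi> x * \<pi> k a = \<xi> x * \<pi> l a"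
    using agree x by (auto simp: char_add_def adjoint_hom_pow)
  moreover have "\<xi> x \<noteq> 0" using digits_dual assms(1) dual_nonzero by blast
  ultimately show "\<pi> k a = \<pi> l a" by simp
qed

lemma digits_separated:
  assumes "\<eta> \<in> digits A \<pi> j" "\<xi> \<in> digits A \<pi> j" "\<forall>a\<in>ker_pow A j. \<eta> a = \<xi> a"
  shows "\<eta> = \<xi>"
  using assms
proof (induction j arbitrary: \<eta> \<xi>)
  case (Suc j)
  then obtain \<eta>' k \<xi>' l where *: "\<eta> = digit_char j \<eta>' k" "\<xi> = digit_char j \<xi>' l"
    "\<eta>' \<in> digits A \<pi> j" "\<xi>' \<in> digits A \<pi> j" "k < m" "l < m"
    unfolding digits_Suc_image by auto
  have "\<forall>a\<in>ker_pow A j. \<eta>' a = \<xi>' a"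
    using Suc.prems(3) ker_pow_mono[of j] digit_char_ker *(1,2,5,6) by (metis subsetD)
  then have "\<eta>' = \<xi>'" using Suc.IH *(3,4) by blast
  then show ?case using digit_char_separated[of \<xi>' j k l] * Suc.prems(3) by auto
qed simp

lemma digit_char_inj: "inj_on (\<lambda>(\<eta>, k). digit_char j \<eta> k) (digits A \<pi> j \<times> {..<m})"
proof (rule inj_onI)
  fix p q
  assume "p \<in> digits A \<pi> j \<times> {..<m}" "q \<in> digits A \<pi> j \<times> {..<m}"
    and eq: "(\<lambda>(\<eta>, k). digit_char j \<eta> k) p = (\<lambda>(\<eta>, k). digit_char j \<eta> k) q"
  then obtain \<eta> k \<xi> l where *: "p = (\<eta>, k)" "q = (\<xi>, l)"
    "\<eta> \<in> digits A \<pi> j" "\<xi> \<in> digits A \<pi> j" "k < m" "l < m" by auto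
  then have eq: "digit_char j \<eta> k = digit_char j \<xi> l" using eq by simp
  have "\<forall>a\<in>ker_pow A j. \<eta> a = \<xi> a"
    using eq digit_char_ker *(5,6) by metis
  then have "\<eta> = \<xi>" by (rule digits_separated[OF *(3,4)])
  then show "p = q"
    using digit_char_separated[OF *(4,5,6)] * eq by simp
qed

lemma digits_finite_card: "finite (digits A \<pi> j) \<and> card (digits A \<pi> j) = m ^ j"
proof (induction j)
  case (Suc j)
  then show ?case
    unfolding digits_Suc_image
    by (simp add: card_image[OF digit_char_inj] card_cartesian_product)
qed simp

lemma digits_complete: "complete_characters (ker_pow A j) (digits A \<pi> j)"
  using digits_finite_card[of j] digits_dual[of j] card_ker_pow[of j] digits_separated
  by (intro complete_charactersI ker_pow_subgroup) auto

lemma sum_digits_Suc: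
  "(\<Sum>\<eta>\<in>digits A \<pi> (Suc j). F \<eta>) = (\<Sum>\<eta>\<in>digits A \<pi> j. \<Sum>k<m. F (digit_char j \<eta> k))"
  unfolding digits_Suc_image sum.reindex[OF digit_char_inj] sum.cartesian_product
  by (intro sum.cong) auto

end

section \<open>Finite families of square integrable functions\<close>

context haar_group
begin

lemma L2_measurable: "f \<in> L2 M \<Longrightarrow> f \<in> borel_measurable M"
  by (simp add: L2_def)

lemma L2_mult_cnj_integrable:
  assumes "f \<in> L2 M" "g \<in> L2 M"
  shows "integrable M (\<lambda>x. f x * cnj (g x))"
proof (rule Bochner_Integration.integrable_bound)
  show "integrable M (\<lambda>x. (norm (f x))\<^sup>2 + (norm (g x))\<^sup>2)"
    using assms by (simp add: L2_def)
  have "g \<in> borel_measurable M" using assms by (simp add: L2_def)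
  then have "(\<lambda>x. cnj (g x)) \<in> borel_measurable M"
    by (rule measurable_compose) (intro borel_measurable_continuous_onI continuous_intros)
  then show "(\<lambda>x. f x * cnj (g x)) \<in> borel_measurable M"
    using assms by (intro borel_measurable_times) (auto simp: L2_def)
  show "AE x in M. norm (f x * cnj (g x)) \<le> norm ((norm (f x))\<^sup>2 + (norm (g x))\<^sup>2)"
  proof (rule AE_I2)
    fix x
    have "2 * (norm (f x) * norm (g x)) \<le> (norm (f x))\<^sup>2 + (norm (g x))\<^sup>2"
      using sum_squares_bound[of "norm (f x)" "norm (g x)"] by simp
    moreover have "0 \<le> norm (f x) * norm (g x)" by simp
    ultimately show "norm (f x * cnj (g x)) \<le> norm ((norm (f x))\<^sup>2 + (norm (g x))\<^sup>2)"
      unfolding norm_mult complex_mod_cnj real_norm_def by linarith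
  qed
qed

lemma L2_const: "(\<lambda>x. c) \<in> L2 M"
  by (simp add: L2_def)

lemma L2_integrable: "f \<in> L2 M \<Longrightarrow> integrable M f"
  using L2_mult_cnj_integrable[OF _ L2_const[of 1]] by simp

lemma L2_add:
  assumes "f \<in> L2 M" "g \<in> L2 M"
  shows "(\<lambda>x. f x + g x) \<in> L2 M"
proof -
  have [measurable]: "f \<in> borel_measurable M" "g \<in> borel_measurable M"
    using assms by (auto simp: L2_def)
  have "integrable M (\<lambda>x. (norm (f x + g x))\<^sup>2)"
  proof (rule Bochner_Integration.integrable_bound)
    show "integrable M (\<lambda>x. 2 * (norm (f x))\<^sup>2 + 2 * (norm (g x))\<^sup>2)"
      using assms by (simp add: L2_def)
    show "AE x in M. norm ((norm (f x + g x))\<^sup>2) \<le> norm (2 * (norm (f x))\<^sup>2 + 2 * (norm (g x))\<^sup>2)"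
    proof (rule AE_I2)
      fix x
      have "(norm (f x + g x))\<^sup>2 \<le> (norm (f x) + norm (g x))\<^sup>2"
        by (intro power_mono norm_triangle_ineq) simp
      also have "\<dots> \<le> 2 * (norm (f x))\<^sup>2 + 2 * (norm (g x))\<^sup>2"
        using sum_squares_bound[of "norm (f x)" "norm (g x)"] by (simp add: power2_sum)
      finally show "norm ((norm (f x + g x))\<^sup>2) \<le> norm (2 * (norm (f x))\<^sup>2 + 2 * (norm (g x))\<^sup>2)"
        by simp
    qed
  qed measurable
  then show ?thesis by (simp add: L2_def)
qed

lemma L2_scale: "f \<in> L2 M \<Longrightarrow> (\<lambda>x. c * f x) \<in> L2 M"
  by (auto simp: L2_def norm_mult power_mult_distrib)

lemma L2_sum:
  assumes "finite I" "\<And>i. i \<in> I \<Longrightarrow> F i \<in> L2 M"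
  shows "(\<lambda>x. \<Sum>i\<in>I. c i * F i x) \<in> L2 M"
  using assms
proof (induction I)
  case (insert i I)
  then show ?case
    using L2_add[OF L2_scale, of "F i" "\<lambda>x. \<Sum>i\<in>I. c i * F i x" "c i"] by simp
qed (simp add: L2_const)

lemma L2_translate:
  assumes "f \<in> L2 M"
  shows "translate a f \<in> L2 M"
proof -
  have "integrable M (\<lambda>x. (norm (f (x + - a)))\<^sup>2)"
    using assms by (intro integrable_shift) (simp add: L2_def)
  moreover have "(\<lambda>x. f (x + - a)) \<in> borel_measurable M"
    by (rule measurable_compose[OF shift_measurable L2_measurable[OF assms]])
  ultimately show ?thesis by (simp add: L2_def translate_def)
qed

lemma AE_translate:
  assumes "AE x in M. f x = g x"
  shows "AE x in M. translate a f x = translate a g x"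
  using AE_shift[OF assms, of "- a"] by (simp add: translate_def)

lemma AE_sum_cong:
  assumes "finite I" "\<And>i. i \<in> I \<Longrightarrow> AE x in M. F i x = G i x"
  shows "AE x in M. (\<Sum>i\<in>I. c i * F i x) = (\<Sum>i\<in>I. c i * G i x)"
proof -
  have "AE x in M. \<forall>i\<in>I. F i x = G i x"
    using assms by (simp add: AE_finite_all)
  then show ?thesis by eventually_elim simp
qed

lemma l2_inner_AE_cong:
  assumes "f \<in> L2 M" "g \<in> L2 M" "f' \<in> L2 M" "g' \<in> L2 M"
    and "AE x in M. f x = f' x" "AE x in M. g x = g' x"
  shows "l2_inner M f g = l2_inner M f' g'"
  unfolding l2_inner_def
proof (rule integral_cong_AE)
  show "(\<lambda>x. f x * cnj (g x)) \<in> borel_measurable M" "(\<lambda>x. f' x * cnj (g' x)) \<in> borel_measurable M"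
    by (intro borel_measurable_integrable L2_mult_cnj_integrable assms)+
  show "AE x in M. f x * cnj (g x) = f' x * cnj (g' x)"
    using assms(5,6) by eventually_elim simp
qed

lemma fourier_AE_cong:
  assumes "f \<in> L2 M" "g \<in> L2 M" "AE x in M. f x = g x" "\<xi> \<in> dual_group"
  shows "fourier M f \<xi> = fourier M g \<xi>"
proof -
  have "\<xi> \<in> L2 M"
    using continuous_measurable[OF dual_continuous[OF assms(4)]] by (simp add: L2_def dual_norm[OF assms(4)])
  then show ?thesis
    using l2_inner_AE_cong[OF assms(1) _ assms(2) _ assms(3), of \<xi> \<xi>] by (simp add: l2_inner_def fourier_def)
qed

lemma l2_inner_sum:
  assumes "finite I" "\<And>i. i \<in> I \<Longrightarrow> F i \<in> L2 M" "finite J" "\<And>k. k \<in> J \<Longrightarrow> G k \<in> L2 M"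
  shows "l2_inner M (\<lambda>x. \<Sum>i\<in>I. c i * F i x) (\<lambda>x. \<Sum>k\<in>J. d k * G k x)
       = (\<Sum>i\<in>I. \<Sum>k\<in>J. c i * cnj (d k) * l2_inner M (F i) (G k))"
proof -
  have int: "integrable M (\<lambda>x. c i * cnj (d k) * (F i x * cnj (G k x)))" if "i \<in> I" "k \<in> J" for i k
    using L2_mult_cnj_integrable assms that by simp
  have "l2_inner M (\<lambda>x. \<Sum>i\<in>I. c i * F i x) (\<lambda>x. \<Sum>k\<in>J. d k * G k x)
      = (LINT x|M. (\<Sum>i\<in>I. \<Sum>k\<in>J. c i * cnj (d k) * (F i x * cnj (G k x))))"
    unfolding l2_inner_def by (simp add: sum_product algebra_simps)
  also have "\<dots> = (\<Sum>i\<in>I. LINT x|M. (\<Sum>k\<in>J. c i * cnj (d k) * (F i x * cnj (G k x))))"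
    by (intro Bochner_Integration.integral_sum Bochner_Integration.integrable_sum int)
  also have "\<dots> = (\<Sum>i\<in>I. \<Sum>k\<in>J. LINT x|M. c i * cnj (d k) * (F i x * cnj (G k x)))"
    by (intro sum.cong refl Bochner_Integration.integral_sum int)
  also have "\<dots> = (\<Sum>i\<in>I. \<Sum>k\<in>J. c i * cnj (d k) * l2_inner M (F i) (G k))"
    by (simp add: l2_inner_def)
  finally show ?thesis .
qed

lemma l2_inner_sum_orthonormal:
  assumes "finite I" "l2_orthonormal M F I"
  shows "l2_inner M (\<lambda>x. \<Sum>i\<in>I. c i * F i x) (\<lambda>x. \<Sum>i\<in>I. d i * F i x) = (\<Sum>i\<in>I. c i * cnj (d i))"
proof -
  have "l2_inner M (\<lambda>x. \<Sum>i\<in>I. c i * F i x) (\<lambda>x. \<Sum>i\<in>I. d i * F i x)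
      = (\<Sum>i\<in>I. \<Sum>k\<in>I. c i * cnj (d k) * l2_inner M (F i) (F k))"
    using assms by (intro l2_inner_sum) (auto simp: l2_orthonormal_def)
  also have "\<dots> = (\<Sum>i\<in>I. \<Sum>k\<in>I. if k = i then c i * cnj (d k) else 0)"
    using assms(2) by (intro sum.cong refl) (auto simp: l2_orthonormal_def)
  also have "\<dots> = (\<Sum>i\<in>I. c i * cnj (d i))"
    using assms(1) by (simp add: sum.delta)
  finally show ?thesis .
qed

lemma l2_span_finite:
  assumes "finite I"
  shows "l2_span M F I = {f \<in> L2 M. \<exists>c. AE x in M. f x = (\<Sum>i\<in>I. c i * F i x)}"
proof (intro subset_antisym subsetI)
  fix f assume "f \<in> l2_span M F I"
  then obtain J c where f: "f \<in> L2 M" "J \<subseteq> I" "AE x in M. f x = (\<Sum>i\<in>J. c i * F i x)"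
    by (auto simp: l2_span_def)
  have "(\<Sum>i\<in>I. (if i \<in> J then c i else 0) * F i x) = (\<Sum>i\<in>J. c i * F i x)" for x
    using assms f(2) by (intro sum.mono_neutral_cong_right) auto
  then have "AE x in M. f x = (\<Sum>i\<in>I. (if i \<in> J then c i else 0) * F i x)"
    using f(3) by simp
  then show "f \<in> {f \<in> L2 M. \<exists>c. AE x in M. f x = (\<Sum>i\<in>I. c i * F i x)}"
    by (intro CollectI conjI f(1) exI[of _ "\<lambda>i. if i \<in> J then c i else 0"])
qed (use assms in \<open>auto simp: l2_span_def\<close>)

lemma l2_orthonormal_independent:
  assumes "l2_orthonormal M F I"
  shows "l2_independent M F I"
  unfolding l2_independent_def
proof (intro allI impI, elim conjE)
  fix J c assume J: "finite J" "J \<subseteq> I" and zero: "AE x in M. (\<Sum>i\<in>J. c i * F i x) = 0"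
  have on: "l2_orthonormal M F J" using assms J(2) unfolding l2_orthonormal_def by (meson subsetD)
  then have F: "\<And>i. i \<in> J \<Longrightarrow> F i \<in> L2 M" by (simp add: l2_orthonormal_def)
  let ?f = "\<lambda>x. \<Sum>i\<in>J. c i * F i x"
  have "(\<Sum>i\<in>J. c i * cnj (c i)) = l2_inner M ?f ?f"
    by (rule l2_inner_sum_orthonormal[OF J(1) on, symmetric])
  also have "\<dots> = l2_inner M (\<lambda>x. 0) (\<lambda>x. 0)"
    by (intro l2_inner_AE_cong L2_sum L2_const J F zero)
  also have "\<dots> = 0" by (simp add: l2_inner_def)
  finally have "(\<Sum>i\<in>J. complex_of_real ((norm (c i))\<^sup>2)) = 0"
    unfolding complex_norm_square .
  then have "(\<Sum>i\<in>J. (norm (c i))\<^sup>2) = 0"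
    unfolding of_real_sum[symmetric] of_real_eq_0_iff .
  then show "\<forall>i\<in>J. c i = 0" using J(1) by (simp add: sum_nonneg_eq_0_iff)
qed

lemma l2_orthonormal_basis_span:
  assumes "finite I" "l2_orthonormal M F I"
  shows "l2_orthonormal_basis M F I (l2_span M F I)"
proof -
  have "F i \<in> l2_span M F I" if "i \<in> I" for i
    using that assms(2) unfolding l2_span_def l2_orthonormal_def
    by (intro CollectI conjI exI[of _ "{i}"] exI[of _ "\<lambda>i. 1"]) auto
  then show ?thesis
    using assms l2_orthonormal_independent
    by (auto simp: l2_orthonormal_basis_def l2_basis_def)
qed

end

section \<open>Spectral coordinates at one level\<close>

text \<open>
  A function with orthonormal translates under a finite group, together with the characters of
  this group. It is used with \<open>\<Phi> = \<phi>\<^sub>j\<^sub>+\<^sub>1\<close>, \<open>K = ker A\<^sup>j\<^sup>+\<^sup>1\<close> and \<open>D = D(A\<^sup>j\<^sup>+\<^sup>1)\<close>.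
\<close>
locale spectral_level = haar_group M
  for M :: "'a::{topological_ab_group_add, t2_space, second_countable_topology} measure" +
  fixes K :: "'a set" and D :: "('a \<Rightarrow> complex) set" and \<Phi> :: "'a \<Rightarrow> complex"
  assumes K: "finite_subgroup K" and D: "complete_characters K D"
    and separated: "\<And>\<eta> \<xi>. \<eta> \<in> D \<Longrightarrow> \<xi> \<in> D \<Longrightarrow> \<forall>a\<in>K. \<eta> a = \<xi> a \<Longrightarrow> \<eta> = \<xi>"
    and orthonormal: "l2_orthonormal M (\<lambda>a. translate a \<Phi>) K"
begin

lemma finite_K [simp]: "finite K"
  by (rule finite_subgroup_finite[OF K])

lemma finite_D [simp]: "finite D" and D_dual: "\<eta> \<in> D \<Longrightarrow> \<eta> \<in> dual_group"
  using D by (auto simp: complete_characters_def)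

lemma K_nonempty [simp]: "K \<noteq> {}"
  using finite_subgroup_zero[OF K] by auto

lemma translate_\<Phi>_L2: "a \<in> K \<Longrightarrow> translate a \<Phi> \<in> L2 M"
  using orthonormal by (simp add: l2_orthonormal_def)

lemma \<Phi>_L2: "\<Phi> \<in> L2 M"
  using translate_\<Phi>_L2[OF finite_subgroup_zero[OF K]] by (simp add: translate_def)

lemma isotypic_translates: "isotypic K \<eta> \<Phi> = (\<lambda>x. \<Sum>a\<in>K. \<eta> a * translate a \<Phi> x)"
  by (simp add: isotypic_def translate_def fun_eq_iff)

lemma isotypic_L2: "isotypic K \<eta> \<Phi> \<in> L2 M"
  unfolding isotypic_translates by (intro L2_sum translate_\<Phi>_L2) auto

lemma isotypic_inner:
  assumes "\<eta> \<in> dual_group" "\<xi> \<in> dual_group"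
  shows "l2_inner M (isotypic K \<eta> \<Phi>) (isotypic K \<xi> \<Phi>) =
    (if \<forall>a\<in>K. \<eta> a = \<xi> a then of_nat (card K) else 0)"
  unfolding isotypic_translates
  using l2_inner_sum_orthonormal[OF finite_K orthonormal] character_orthogonality[OF K assms] by simp

text \<open>
  Normalised so that its Fourier transform is \<open>\<beta> \<eta>\<close> times that of \<open>\<Phi>\<close> on the coset of \<open>\<eta>\<close>.
\<close>
definition spectral :: "(('a \<Rightarrow> complex) \<Rightarrow> complex) \<Rightarrow> 'a \<Rightarrow> complex" where
  "spectral \<beta> x = (\<Sum>\<eta>\<in>D. \<beta> \<eta> / of_nat (card K) * isotypic K \<eta> \<Phi> x)"

lemma spectral_cong:
  assumes "\<And>\<eta>. \<eta> \<in> D \<Longrightarrow> \<beta> \<eta> = \<gamma> \<eta>"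
  shows "spectral \<beta> x = spectral \<gamma> x"
  unfolding spectral_def using assms by simp

lemma spectral_L2: "spectral \<beta> \<in> L2 M"
  unfolding spectral_def by (intro L2_sum isotypic_L2) auto

lemma spectral_inner: "l2_inner M (spectral \<beta>) (spectral \<gamma>) = (\<Sum>\<eta>\<in>D. \<beta> \<eta> * cnj (\<gamma> \<eta>)) / of_nat (card K)"
proof -
  have "l2_inner M (spectral \<beta>) (spectral \<gamma>) =
      (\<Sum>\<eta>\<in>D. \<Sum>\<xi>\<in>D. \<beta> \<eta> / of_nat (card K) * cnj (\<gamma> \<xi> / of_nat (card K)) *
        l2_inner M (isotypic K \<eta> \<Phi>) (isotypic K \<xi> \<Phi>))"
    unfolding spectral_def by (intro l2_inner_sum isotypic_L2) auto
  also have "\<dots> = (\<Sum>\<eta>\<in>D. \<Sum>\<xi>\<in>D. if \<xi> = \<eta> then \<beta> \<eta> * cnj (\<gamma> \<xi>) / of_nat (card K) else 0)"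
    using separated by (intro sum.cong refl) (auto simp: isotypic_inner D_dual)
  also have "\<dots> = (\<Sum>\<eta>\<in>D. \<beta> \<eta> * cnj (\<gamma> \<eta>)) / of_nat (card K)"
    by (simp add: sum.delta sum_divide_distrib)
  finally show ?thesis .
qed

lemma spectral_translate:
  assumes "b \<in> K"
  shows "translate b (spectral \<beta>) = spectral (\<lambda>\<eta>. cnj (\<eta> b) * \<beta> \<eta>)"
proof
  fix x
  show "translate b (spectral \<beta>) x = spectral (\<lambda>\<eta>. cnj (\<eta> b) * \<beta> \<eta>) x"
    unfolding translate_def spectral_def
    by (intro sum.cong refl) (simp add: isotypic_shift[OF K D_dual assms])
qed

lemma spectral_sum: "(\<Sum>i\<in>I. c i * spectral (\<beta> i) x) = spectral (\<lambda>\<eta>. \<Sum>i\<in>I. c i * \<beta> i \<eta>) x"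
proof -
  have "(\<Sum>i\<in>I. c i * spectral (\<beta> i) x) = (\<Sum>i\<in>I. \<Sum>\<eta>\<in>D. c i * (\<beta> i \<eta> / of_nat (card K) * isotypic K \<eta> \<Phi> x))"
    by (simp add: spectral_def sum_distrib_left)
  also have "\<dots> = (\<Sum>\<eta>\<in>D. \<Sum>i\<in>I. c i * (\<beta> i \<eta> / of_nat (card K) * isotypic K \<eta> \<Phi> x))"
    by (rule sum.swap)
  also have "\<dots> = spectral (\<lambda>\<eta>. \<Sum>i\<in>I. c i * \<beta> i \<eta>) x"
    by (simp add: spectral_def sum_divide_distrib sum_distrib_right mult.assoc)
  finally show ?thesis .
qed

lemma translate_spectral: "b \<in> K \<Longrightarrow> translate b \<Phi> x = spectral (\<lambda>\<eta>. cnj (\<eta> b)) x"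
  using isotypic_inversion[OF K D, of b \<Phi> x]
  by (simp add: translate_def spectral_def sum_divide_distrib[symmetric] field_simps)

text \<open>
  The isotypic functions and the translates of \<open>\<Phi>\<close> are combinations of each other, by Fourier inversion on \<open>K\<close>.
\<close>
lemma spectral_span:
  "l2_span M (\<lambda>a. translate a \<Phi>) K = {f \<in> L2 M. \<exists>\<beta>. AE x in M. f x = spectral \<beta> x}"
proof (intro subset_antisym subsetI)
  fix f assume "f \<in> l2_span M (\<lambda>a. translate a \<Phi>) K"
  then obtain c where f: "f \<in> L2 M" "AE x in M. f x = (\<Sum>a\<in>K. c a * translate a \<Phi> x)"
    by (auto simp: l2_span_finite)
  have "(\<Sum>a\<in>K. c a * translate a \<Phi> x) = spectral (\<lambda>\<eta>. \<Sum>a\<in>K. c a * cnj (\<eta> a)) x" for x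
    unfolding spectral_sum[symmetric] by (simp add: translate_spectral)
  then show "f \<in> {f \<in> L2 M. \<exists>\<beta>. AE x in M. f x = spectral \<beta> x}" using f by auto
next
  fix f assume "f \<in> {f \<in> L2 M. \<exists>\<beta>. AE x in M. f x = spectral \<beta> x}"
  then obtain \<beta> where f: "f \<in> L2 M" "AE x in M. f x = spectral \<beta> x" by auto
  have "spectral \<beta> x = (\<Sum>a\<in>K. (\<Sum>\<eta>\<in>D. \<beta> \<eta> / of_nat (card K) * \<eta> a) * translate a \<Phi> x)" for x
    unfolding spectral_def isotypic_translates sum_distrib_left sum_distrib_right
    by (subst sum.swap) (simp add: algebra_simps)
  then show "f \<in> l2_span M (\<lambda>a. translate a \<Phi>) K"
    using f by (auto simp: l2_span_finite)
qed

lemma fourier_spectral: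
  assumes \<xi>: "\<xi> \<in> dual_group" and \<eta>: "\<eta> \<in> D" and agree: "\<And>a. a \<in> K \<Longrightarrow> \<xi> a = \<eta> a"
  shows "fourier M (spectral \<beta>) \<xi> = \<beta> \<eta> * fourier M \<Phi> \<xi>"
proof -
  have \<xi>L2: "\<xi> \<in> L2 M"
    using continuous_measurable[OF dual_continuous[OF \<xi>]] by (simp add: L2_def dual_norm[OF \<xi>])
  have iso: "fourier M (isotypic K \<zeta> \<Phi>) \<xi> = (if \<zeta> = \<eta> then of_nat (card K) * fourier M \<Phi> \<xi> else 0)"
    if "\<zeta> \<in> D" for \<zeta>
    using fourier_isotypic[OF L2_integrable[OF \<Phi>_L2] \<xi>, of K \<zeta>]
      character_orthogonality[OF K D_dual[OF that] \<xi>] agree separated[OF that \<eta>] by auto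
  have "fourier M (spectral \<beta>) \<xi> = l2_inner M (spectral \<beta>) (\<lambda>x. \<Sum>i\<in>{()}. 1 * \<xi> x)"
    by (simp add: fourier_def l2_inner_def)
  also have "\<dots> = (\<Sum>\<zeta>\<in>D. \<beta> \<zeta> / of_nat (card K) * fourier M (isotypic K \<zeta> \<Phi>) \<xi>)"
    unfolding spectral_def by (subst l2_inner_sum) (auto simp: isotypic_L2 \<xi>L2 l2_inner_def fourier_def)
  also have "\<dots> = (\<Sum>\<zeta>\<in>D. if \<zeta> = \<eta> then \<beta> \<zeta> * fourier M \<Phi> \<xi> else 0)"
    by (intro sum.cong refl) (simp add: iso)
  also have "\<dots> = \<beta> \<eta> * fourier M \<Phi> \<xi>" using \<eta> by (simp add: sum.delta)
  finally show ?thesis .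
qed

end

declare digits.simps(2) [simp del]

section \<open>Wavelet decomposition\<close>

locale dual_dilation = haar_group M + dilation_digits A m \<pi>
  for M :: "'a::{topological_ab_group_add, t2_space, second_countable_topology} measure"
    and A :: "'a \<Rightarrow> 'a" and m :: nat and \<pi> :: "nat \<Rightarrow> 'a \<Rightarrow> complex" +
  assumes dense: "closure (\<Union>i. ker_pow A i) = UNIV"
begin

lemma fourier_inj:
  assumes f: "f \<in> L2 M" and g: "g \<in> L2 M"
    and eq: "\<And>\<xi>. \<xi> \<in> dual_group \<Longrightarrow> fourier M f \<xi> = fourier M g \<xi>"
  shows "AE x in M. f x = g x"
proof -
  have "integrable M (\<lambda>x. f x - g x)"
    using f g by (simp add: L2_integrable)
  then have "AE x in M. f x - g x = 0"
  proof (rule fourier_uniqueness[OF ker_pow_mono dense ker_pow_subgroup digits_complete])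
    fix \<xi> :: "'a \<Rightarrow> complex" assume \<xi>: "\<xi> \<in> dual_group"
    have c: "continuous_on UNIV (\<lambda>x. cnj (\<xi> x))"
      by (intro continuous_on_cnj dual_continuous \<xi>)
    have "fourier M (\<lambda>x. f x - g x) \<xi> = fourier M f \<xi> - fourier M g \<xi>"
      unfolding fourier_def left_diff_distrib
      by (intro Bochner_Integration.integral_diff integrable_mult_continuous L2_integrable f g c)
    then show "fourier M (\<lambda>x. f x - g x) \<xi> = 0" using eq[OF \<xi>] by simp
  qed
  then show ?thesis by simp
qed

lemma spectral_levelI:
  assumes "l2_orthonormal M (\<lambda>a. translate a \<Phi>) (ker_pow A n)"
  shows "spectral_level M (ker_pow A n) (digits A \<pi> n) \<Phi>"
  using assms digits_separated ker_pow_subgroup digits_complete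
  by unfold_locales auto

lemma digit_representative:
  assumes "\<xi> \<in> dual_group"
  shows "\<exists>\<eta>\<in>digits A \<pi> n. \<forall>a\<in>ker_pow A n. \<xi> a = \<eta> a"
  using complete_characters_representative[OF ker_pow_subgroup digits_complete assms] by metis

end

locale dilation_level = dual_dilation M A m \<pi>
  for M :: "'a::{topological_ab_group_add, t2_space, second_countable_topology} measure"
    and A :: "'a \<Rightarrow> 'a" and m :: nat and \<pi> :: "nat \<Rightarrow> 'a \<Rightarrow> complex" +
  fixes j :: nat and \<Phi> :: "'a \<Rightarrow> complex"
  assumes orthonormal_translates: "l2_orthonormal M (\<lambda>a. translate a \<Phi>) (ker_pow A (Suc j))"
begin

sublocale spectral_level M "ker_pow A (Suc j)" "digits A \<pi> (Suc j)" \<Phi>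
  by (rule spectral_levelI[OF orthonormal_translates])

text \<open>
  Otherwise the transform of the isotypic function for \<open>\<eta>\<close> would vanish, although its norm is not zero. This is
  what makes the mask well defined.
\<close>
lemma fourier_nonzero_on_coset:
  assumes \<eta>: "\<eta> \<in> dual_group"
  shows "\<exists>\<xi>\<in>dual_group. (\<forall>a\<in>ker_pow A (Suc j). \<eta> a = \<xi> a) \<and> fourier M \<Phi> \<xi> \<noteq> 0"
proof (rule ccontr)
  let ?E = "isotypic (ker_pow A (Suc j)) \<eta> \<Phi>"
  assume "\<not> (\<exists>\<xi>\<in>dual_group. (\<forall>a\<in>ker_pow A (Suc j). \<eta> a = \<xi> a) \<and> fourier M \<Phi> \<xi> \<noteq> 0)"
  then have zero: "fourier M \<Phi> \<xi> = 0" if "\<xi> \<in> dual_group" "\<forall>a\<in>ker_pow A (Suc j). \<eta> a = \<xi> a" for \<xi>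
    using that by blast
  have "fourier M ?E \<xi> = 0" if "\<xi> \<in> dual_group" for \<xi>
    using fourier_isotypic[OF L2_integrable[OF \<Phi>_L2] that, of "ker_pow A (Suc j)" \<eta>]
      character_orthogonality[OF K \<eta> that] zero[OF that] by auto
  then have "AE x in M. ?E x = 0"
    by (intro fourier_inj isotypic_L2 L2_const) (simp add: fourier_def)
  then have "l2_inner M ?E ?E = l2_inner M (\<lambda>x. 0) (\<lambda>x. 0)"
    by (intro l2_inner_AE_cong isotypic_L2 L2_const)
  then show False
    using isotypic_inner[OF \<eta> \<eta>] by (simp add: l2_inner_def)
qed

text \<open>
  The mask is a definite description; existence of the factor comes from \<open>fourier_spectral\<close>, uniqueness from
  \<open>fourier_nonzero_on_coset\<close>.
\<close>
lemma mask_eq_coefficient: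
  assumes \<phi>: "\<phi> (Suc j) = \<Phi>" "\<phi> j \<in> L2 M" "AE x in M. \<phi> j x = spectral \<beta> x"
    and \<eta>: "\<eta> \<in> digits A \<pi> (Suc j)"
  shows "mask M A \<phi> j \<eta> = \<beta> \<eta>"
proof -
  let ?C = "{\<xi> \<in> dual_group. \<forall>a\<in>ker_pow A (Suc j). \<xi> a = \<eta> a}"
  have eq: "fourier M (\<phi> j) \<xi> = \<beta> \<eta> * fourier M \<Phi> \<xi>" if "\<xi> \<in> ?C" for \<xi>
    using fourier_AE_cong[OF \<phi>(2) spectral_L2 \<phi>(3)] fourier_spectral[OF _ \<eta>] that by auto
  have "(THE \<mu>. \<forall>\<xi>\<in>?C. fourier M (\<phi> j) \<xi> = \<mu> * fourier M \<Phi> \<xi>) = \<beta> \<eta>"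
  proof (rule the_equality)
    show "\<forall>\<xi>\<in>?C. fourier M (\<phi> j) \<xi> = \<beta> \<eta> * fourier M \<Phi> \<xi>" using eq by blast
  next
    fix \<mu> assume \<mu>: "\<forall>\<xi>\<in>?C. fourier M (\<phi> j) \<xi> = \<mu> * fourier M \<Phi> \<xi>"
    obtain \<xi> where \<xi>: "\<xi> \<in> dual_group" "\<forall>a\<in>ker_pow A (Suc j). \<eta> a = \<xi> a" "fourier M \<Phi> \<xi> \<noteq> 0"
      using fourier_nonzero_on_coset[OF D_dual[OF \<eta>]] by blast
    then have C: "\<xi> \<in> ?C" by simp
    have "\<mu> * fourier M \<Phi> \<xi> = \<beta> \<eta> * fourier M \<Phi> \<xi>"
      using bspec[OF \<mu> C] eq[OF C] by (rule trans[OF sym])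
    then show "\<mu> = \<beta> \<eta>" using \<xi>(3) by simp
  qed
  then show ?thesis
    unfolding mask_def \<phi>(1) char_coset_annihilator[OF D_dual[OF \<eta>]] .
qed

lemma spectral_translate_coarse:
  "a \<in> ker_pow A j \<Longrightarrow> translate a (spectral \<beta>) x = spectral (\<lambda>\<eta>. cnj (\<eta> a) * \<beta> \<eta>) x"
  using spectral_translate[of a \<beta>] ker_pow_mono[of j] by (metis subsetD)

context
  fixes B :: "('a \<Rightarrow> complex) \<Rightarrow> nat \<Rightarrow> nat \<Rightarrow> complex" and \<beta> :: "nat \<Rightarrow> ('a \<Rightarrow> complex) \<Rightarrow> complex"
  assumes unitary: "\<And>\<eta>. \<eta> \<in> digits A \<pi> j \<Longrightarrow> unitary_matrix m (B \<eta>)"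
    and \<beta>: "\<And>\<nu> \<eta> k. \<nu> < m \<Longrightarrow> \<eta> \<in> digits A \<pi> j \<Longrightarrow> k < m \<Longrightarrow>
      \<beta> \<nu> (digit_char j \<eta> k) = of_real (sqrt (real m)) * B \<eta> \<nu> k"
begin

text \<open>
  Row orthogonality of the matrices \<open>B \<eta>\<close> disposes of the index \<open>k\<close>; the remaining sum over the digits at
  level \<open>j\<close> is the completeness relation on \<open>ker A\<^sup>j\<close>.
\<close>
lemma wavelet_translates_inner:
  assumes \<nu>: "\<nu> < m" "\<mu> < m" and ab: "a \<in> ker_pow A j" "b \<in> ker_pow A j"
  shows "l2_inner M (translate a (spectral (\<beta> \<nu>))) (translate b (spectral (\<beta> \<mu>)))
       = (if \<nu> = \<mu> \<and> a = b then 1 else 0)"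
proof -
  let ?s = "complex_of_real (sqrt (real m))"
  have s: "?s * ?s = of_nat m"
    by (simp flip: of_real_mult)
  have ab': "a \<in> ker_pow A (Suc j)" "b \<in> ker_pow A (Suc j)"
    using ab ker_pow_mono by blast+
  have "l2_inner M (translate a (spectral (\<beta> \<nu>))) (translate b (spectral (\<beta> \<mu>))) =
     (\<Sum>\<zeta>\<in>digits A \<pi> (Suc j). cnj (\<zeta> a) * \<beta> \<nu> \<zeta> * cnj (cnj (\<zeta> b) * \<beta> \<mu> \<zeta>)) / of_nat (m ^ Suc j)"
    unfolding spectral_translate[OF ab'(1)] spectral_translate[OF ab'(2)] spectral_inner card_ker_pow ..
  also have "(\<Sum>\<zeta>\<in>digits A \<pi> (Suc j). cnj (\<zeta> a) * \<beta> \<nu> \<zeta> * cnj (cnj (\<zeta> b) * \<beta> \<mu> \<zeta>)) =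
     (\<Sum>\<eta>\<in>digits A \<pi> j. \<Sum>k<m. of_nat m * \<eta> (b - a) * (B \<eta> \<nu> k * cnj (B \<eta> \<mu> k)))"
    unfolding sum_digits_Suc
  proof (intro sum.cong refl)
    fix \<eta> k assume \<eta>: "\<eta> \<in> digits A \<pi> j" and k: "k \<in> {..<m}"
    have "\<eta> \<in> dual_group" using digits_dual \<eta> by blast
    then show "cnj (digit_char j \<eta> k a) * \<beta> \<nu> (digit_char j \<eta> k) *
        cnj (cnj (digit_char j \<eta> k b) * \<beta> \<mu> (digit_char j \<eta> k)) =
        of_nat m * \<eta> (b - a) * (B \<eta> \<nu> k * cnj (B \<eta> \<mu> k))"
      using k ab \<nu> \<eta> by (simp add: digit_char_ker \<beta> dual_diff s[symmetric] mult_ac)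
  qed
  also have "\<dots> = (\<Sum>\<eta>\<in>digits A \<pi> j. of_nat m * \<eta> (b - a) * (if \<nu> = \<mu> then 1 else 0))"
    unfolding sum_distrib_left[symmetric]
    using unitary \<nu> by (intro sum.cong refl) (simp add: unitary_matrix_def)
  also have "\<dots> = of_nat m * (if \<nu> = \<mu> then 1 else 0) * (\<Sum>\<eta>\<in>digits A \<pi> j. \<eta> (b - a))"
    by (simp add: sum_distrib_left mult_ac)
  also have "(\<Sum>\<eta>\<in>digits A \<pi> j. \<eta> (b - a)) = (if a = b then of_nat (m ^ j) else 0)"
    using digits_complete[of j] finite_subgroup_diff[OF ker_pow_subgroup ab(2,1)]
    by (auto simp: complete_characters_def card_ker_pow)
  finally show ?thesis using m_pos by simp
qed

text \<open>
  Given target coefficients \<open>\<gamma>\<close>, the numbers \<open>g \<nu> \<eta>\<close> solve the linear system with the unitary matrix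
  \<open>B \<eta>\<close> for each \<open>\<eta>\<close>, and \<open>d \<nu>\<close> is the function on \<open>ker A\<^sup>j\<close> whose Fourier transform is \<open>g \<nu>\<close>.
\<close>
lemma spectral_wavelet_expansion:
  "\<exists>d. \<forall>x. spectral \<gamma> x = (\<Sum>\<nu><m. \<Sum>a\<in>ker_pow A j. d \<nu> a * translate a (spectral (\<beta> \<nu>)) x)"
proof -
  let ?s = "complex_of_real (sqrt (real m))"
  let ?K = "ker_pow A j" and ?D = "digits A \<pi> j"
  have s: "?s \<noteq> 0" using m_pos by simp
  define g where "g \<nu> \<eta> = (\<Sum>l<m. \<gamma> (digit_char j \<eta> l) * cnj (B \<eta> \<nu> l)) / ?s" for \<nu> \<eta>
  define d where "d \<nu> a = (\<Sum>\<eta>\<in>?D. \<eta> a * g \<nu> \<eta>) / of_nat (m ^ j)" for \<nu> a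
  have d: "(\<Sum>a\<in>?K. d \<nu> a * cnj (\<xi> a)) = g \<nu> \<xi>" if \<xi>: "\<xi> \<in> ?D" for \<nu> \<xi>
  proof -
    have "(\<Sum>a\<in>?K. d \<nu> a * cnj (\<xi> a)) = (\<Sum>a\<in>?K. \<Sum>\<eta>\<in>?D. g \<nu> \<eta> * (\<eta> a * cnj (\<xi> a))) / of_nat (m ^ j)"
      by (simp add: d_def sum_divide_distrib sum_distrib_left sum_distrib_right mult_ac)
    also have "(\<Sum>a\<in>?K. \<Sum>\<eta>\<in>?D. g \<nu> \<eta> * (\<eta> a * cnj (\<xi> a))) =
        (\<Sum>\<eta>\<in>?D. g \<nu> \<eta> * (\<Sum>a\<in>?K. \<eta> a * cnj (\<xi> a)))"
      by (subst sum.swap) (simp add: sum_distrib_left)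
    also have "\<dots> = (\<Sum>\<eta>\<in>?D. if \<eta> = \<xi> then g \<nu> \<eta> * of_nat (m ^ j) else 0)"
      using digits_separated[OF _ \<xi>] digits_dual \<xi>
      by (intro sum.cong refl)
         (auto simp: character_orthogonality[OF ker_pow_subgroup] subset_iff card_ker_pow)
    also have "\<dots> = g \<nu> \<xi> * of_nat (m ^ j)"
      using \<xi> digits_finite_card by (simp add: sum.delta)
    finally show ?thesis using m_pos by simp
  qed
  have "spectral \<gamma> x = (\<Sum>\<nu><m. \<Sum>a\<in>?K. d \<nu> a * translate a (spectral (\<beta> \<nu>)) x)" for x
  proof -
    have "(\<Sum>\<nu><m. \<Sum>a\<in>?K. d \<nu> a * translate a (spectral (\<beta> \<nu>)) x) =
        (\<Sum>\<nu><m. 1 * spectral (\<lambda>\<zeta>. \<Sum>a\<in>?K. d \<nu> a * (cnj (\<zeta> a) * \<beta> \<nu> \<zeta>)) x)"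
    proof (intro sum.cong refl)
      fix \<nu>
      have "(\<Sum>a\<in>?K. d \<nu> a * translate a (spectral (\<beta> \<nu>)) x) =
          (\<Sum>a\<in>?K. d \<nu> a * spectral (\<lambda>\<zeta>. cnj (\<zeta> a) * \<beta> \<nu> \<zeta>) x)"
        by (intro sum.cong refl) (simp only: spectral_translate_coarse)
      then show "(\<Sum>a\<in>?K. d \<nu> a * translate a (spectral (\<beta> \<nu>)) x) =
          1 * spectral (\<lambda>\<zeta>. \<Sum>a\<in>?K. d \<nu> a * (cnj (\<zeta> a) * \<beta> \<nu> \<zeta>)) x"
        by (simp add: spectral_sum)
    qed
    also have "\<dots> = spectral (\<lambda>\<zeta>. \<Sum>\<nu><m. 1 * (\<Sum>a\<in>?K. d \<nu> a * (cnj (\<zeta> a) * \<beta> \<nu> \<zeta>))) x"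
      by (rule spectral_sum)
    also have "\<dots> = spectral \<gamma> x"
    proof (rule spectral_cong)
      fix \<zeta> assume "\<zeta> \<in> digits A \<pi> (Suc j)"
      then obtain \<xi> k where \<zeta>: "\<zeta> = digit_char j \<xi> k" and \<xi>: "\<xi> \<in> ?D" and k: "k < m"
        unfolding digits_Suc_image by auto
      have "(\<Sum>\<nu><m. 1 * (\<Sum>a\<in>?K. d \<nu> a * (cnj (\<zeta> a) * \<beta> \<nu> \<zeta>))) = (\<Sum>\<nu><m. g \<nu> \<xi> * (?s * B \<xi> \<nu> k))"
      proof (intro sum.cong refl)
        fix \<nu> assume "\<nu> \<in> {..<m}"
        then have "\<beta> \<nu> \<zeta> = ?s * B \<xi> \<nu> k" using \<beta> \<xi> k \<zeta> by simp
        moreover have "(\<Sum>a\<in>?K. d \<nu> a * (cnj (\<zeta> a) * \<beta> \<nu> \<zeta>)) = (\<Sum>a\<in>?K. d \<nu> a * cnj (\<xi> a)) * \<beta> \<nu> \<zeta>"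
          unfolding sum_distrib_right using k \<zeta> by (intro sum.cong refl) (simp add: digit_char_ker)
        ultimately show "1 * (\<Sum>a\<in>?K. d \<nu> a * (cnj (\<zeta> a) * \<beta> \<nu> \<zeta>)) = g \<nu> \<xi> * (?s * B \<xi> \<nu> k)"
          using d[OF \<xi>] by simp
      qed
      also have "\<dots> = (\<Sum>\<nu><m. \<Sum>l<m. \<gamma> (digit_char j \<xi> l) * (cnj (B \<xi> \<nu> l) * B \<xi> \<nu> k))"
      proof (intro sum.cong refl)
        fix \<nu>
        have "g \<nu> \<xi> * (?s * B \<xi> \<nu> k) = (\<Sum>l<m. \<gamma> (digit_char j \<xi> l) * cnj (B \<xi> \<nu> l)) * B \<xi> \<nu> k"
          using s by (simp add: g_def)
        then show "g \<nu> \<xi> * (?s * B \<xi> \<nu> k) =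
            (\<Sum>l<m. \<gamma> (digit_char j \<xi> l) * (cnj (B \<xi> \<nu> l) * B \<xi> \<nu> k))"
          by (simp add: sum_distrib_right mult.assoc)
      qed
      also have "\<dots> = (\<Sum>l<m. \<gamma> (digit_char j \<xi> l) * (\<Sum>\<nu><m. cnj (B \<xi> \<nu> l) * B \<xi> \<nu> k))"
        by (subst sum.swap) (simp add: sum_distrib_left)
      also have "\<dots> = (\<Sum>l<m. if l = k then \<gamma> (digit_char j \<xi> l) else 0)"
        using unitary[OF \<xi>] k by (intro sum.cong refl) (simp add: unitary_matrix_def)
      also have "\<dots> = \<gamma> \<zeta>" using k \<zeta> by (simp add: sum.delta)
      finally show "(\<Sum>\<nu><m. 1 * (\<Sum>a\<in>?K. d \<nu> a * (cnj (\<zeta> a) * \<beta> \<nu> \<zeta>))) = \<gamma> \<zeta>" .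
    qed
    finally show ?thesis ..
  qed
  then show ?thesis by blast
qed

text \<open>
  All \<open>m\<close> functions are treated alike: \<open>\<nu> = 0\<close> is the coarse scaling function, the others are the
  wavelets.
\<close>
lemma wavelet_decomposition:
  assumes \<psi>: "\<And>\<nu>. \<nu> < m \<Longrightarrow> \<psi> \<nu> \<in> L2 M"
    "\<And>\<nu>. \<nu> < m \<Longrightarrow> AE x in M. \<psi> \<nu> x = spectral (\<beta> \<nu>) x"
  defines "W \<equiv> \<lambda>\<nu>. l2_span M (\<lambda>a. translate a (\<psi> \<nu>)) (ker_pow A j)"
  shows "l2_orthogonal_direct_sum M (l2_span M (\<lambda>a. translate a \<Phi>) (ker_pow A (Suc j))) W {0..<m}"
    and "\<nu> < m \<Longrightarrow> l2_orthonormal_basis M (\<lambda>a. translate a (\<psi> \<nu>)) (ker_pow A j) (W \<nu>)"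
proof -
  let ?K = "ker_pow A j"
  have fin: "finite ?K" using ker_pow_finite_card by blast
  have T: "translate a (\<psi> \<nu>) \<in> L2 M" if "\<nu> < m" for a \<nu>
    by (rule L2_translate[OF \<psi>(1)[OF that]])
  have TAE: "AE x in M. translate a (\<psi> \<nu>) x = translate a (spectral (\<beta> \<nu>)) x" if "\<nu> < m" for a \<nu>
    by (rule AE_translate[OF \<psi>(2)[OF that]])
  have inner: "l2_inner M (translate a (\<psi> \<nu>)) (translate b (\<psi> \<mu>)) = (if \<nu> = \<mu> \<and> a = b then 1 else 0)"
    if "\<nu> < m" "\<mu> < m" "a \<in> ?K" "b \<in> ?K" for \<nu> \<mu> a b
    unfolding wavelet_translates_inner[OF that, symmetric]
    by (intro l2_inner_AE_cong T TAE L2_translate spectral_L2 that)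
  have "l2_orthonormal M (\<lambda>a. translate a (\<psi> \<nu>)) ?K" if "\<nu> < m" for \<nu>
    using T inner that by (simp add: l2_orthonormal_def)
  then show "\<nu> < m \<Longrightarrow> l2_orthonormal_basis M (\<lambda>a. translate a (\<psi> \<nu>)) ?K (W \<nu>)"
    unfolding W_def by (rule l2_orthonormal_basis_span[OF fin])
  have orth: "l2_inner M f g = 0" if asm: "\<nu> < m" "\<mu> < m" "\<nu> \<noteq> \<mu>" "f \<in> W \<nu>" "g \<in> W \<mu>" for \<nu> \<mu> f g
  proof -
    obtain c d where c: "f \<in> L2 M" "AE x in M. f x = (\<Sum>a\<in>?K. c a * translate a (\<psi> \<nu>) x)"
      and d: "g \<in> L2 M" "AE x in M. g x = (\<Sum>a\<in>?K. d a * translate a (\<psi> \<mu>) x)"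
      using asm(4,5) unfolding W_def l2_span_finite[OF fin] by blast
    have "l2_inner M f g = l2_inner M (\<lambda>x. \<Sum>a\<in>?K. c a * translate a (\<psi> \<nu>) x) (\<lambda>x. \<Sum>a\<in>?K. d a * translate a (\<psi> \<mu>) x)"
      by (intro l2_inner_AE_cong c d L2_sum fin T that)
    also have "\<dots> = (\<Sum>a\<in>?K. \<Sum>b\<in>?K. c a * cnj (d b) * l2_inner M (translate a (\<psi> \<nu>)) (translate b (\<psi> \<mu>)))"
      by (intro l2_inner_sum fin T that)
    also have "\<dots> = 0" using that by (simp add: inner)
    finally show ?thesis .
  qed
  have "f \<in> l2_span M (\<lambda>a. translate a \<Phi>) (ker_pow A (Suc j)) \<longleftrightarrow>
      f \<in> L2 M \<and> (\<exists>u. (\<forall>\<nu>\<in>{0..<m}. u \<nu> \<in> W \<nu>) \<and> (AE x in M. f x = (\<Sum>\<nu>\<in>{0..<m}. u \<nu> x)))" for f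
  proof safe
    assume "f \<in> l2_span M (\<lambda>a. translate a \<Phi>) (ker_pow A (Suc j))"
    then obtain \<gamma> where f: "f \<in> L2 M" "AE x in M. f x = spectral \<gamma> x"
      unfolding spectral_span by blast
    then show "f \<in> L2 M" by simp
    obtain d where d: "\<And>x. spectral \<gamma> x = (\<Sum>\<nu><m. \<Sum>a\<in>?K. d \<nu> a * translate a (spectral (\<beta> \<nu>)) x)"
      using spectral_wavelet_expansion by blast
    define u where "u \<nu> x = (\<Sum>a\<in>?K. d \<nu> a * translate a (\<psi> \<nu>) x)" for \<nu> x
    have "u \<nu> \<in> W \<nu>" if "\<nu> < m" for \<nu>
      unfolding W_def l2_span_finite[OF fin] u_def
      by (intro CollectI conjI L2_sum fin T that exI[of _ "d \<nu>"] AE_I2 refl)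
    moreover have "AE x in M. f x = (\<Sum>\<nu>\<in>{0..<m}. u \<nu> x)"
    proof -
      have "AE x in M. \<forall>\<nu>\<in>{..<m}. u \<nu> x = (\<Sum>a\<in>?K. d \<nu> a * translate a (spectral (\<beta> \<nu>)) x)"
        unfolding u_def using AE_sum_cong[OF fin TAE] by (simp add: AE_finite_all)
      with f(2) show ?thesis
        by eventually_elim (simp add: d atLeast0LessThan)
    qed
    ultimately show "\<exists>u. (\<forall>\<nu>\<in>{0..<m}. u \<nu> \<in> W \<nu>) \<and> (AE x in M. f x = (\<Sum>\<nu>\<in>{0..<m}. u \<nu> x))"
      by (intro exI[of _ u]) auto
  next
    fix u assume f: "f \<in> L2 M" and u: "\<forall>\<nu>\<in>{0..<m}. u \<nu> \<in> W \<nu>"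
      and sum: "AE x in M. f x = (\<Sum>\<nu>\<in>{0..<m}. u \<nu> x)"
    have "\<exists>\<gamma>. AE x in M. u \<nu> x = spectral \<gamma> x" if \<nu>: "\<nu> < m" for \<nu>
    proof -
      have "u \<nu> \<in> W \<nu>" using u \<nu> by simp
      then obtain c where c: "AE x in M. u \<nu> x = (\<Sum>a\<in>?K. c a * translate a (\<psi> \<nu>) x)"
        unfolding W_def l2_span_finite[OF fin] by blast
      have "(\<Sum>a\<in>?K. c a * translate a (spectral (\<beta> \<nu>)) x) =
          spectral (\<lambda>\<zeta>. \<Sum>a\<in>?K. c a * (cnj (\<zeta> a) * \<beta> \<nu> \<zeta>)) x" for x
        unfolding spectral_sum[symmetric] by (intro sum.cong refl) (simp only: spectral_translate_coarse)
      moreover have "AE x in M. (\<Sum>a\<in>?K. c a * translate a (\<psi> \<nu>) x) =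
          (\<Sum>a\<in>?K. c a * translate a (spectral (\<beta> \<nu>)) x)"
        by (intro AE_sum_cong fin TAE \<nu>)
      ultimately have "AE x in M. u \<nu> x = spectral (\<lambda>\<zeta>. \<Sum>a\<in>?K. c a * (cnj (\<zeta> a) * \<beta> \<nu> \<zeta>)) x"
        using c by (auto elim: eventually_elim2)
      then show ?thesis
        by (rule exI[where x = "\<lambda>\<zeta>. \<Sum>a\<in>?K. c a * (cnj (\<zeta> a) * \<beta> \<nu> \<zeta>)"])
    qed
    then obtain \<gamma> where \<gamma>: "\<And>\<nu>. \<nu> < m \<Longrightarrow> AE x in M. u \<nu> x = spectral (\<gamma> \<nu>) x" by metis
    have "AE x in M. (\<Sum>\<nu><m. 1 * u \<nu> x) = (\<Sum>\<nu><m. 1 * spectral (\<gamma> \<nu>) x)"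
      using \<gamma> by (intro AE_sum_cong) auto
    with sum have "AE x in M. f x = spectral (\<lambda>\<zeta>. \<Sum>\<nu><m. 1 * \<gamma> \<nu> \<zeta>) x"
      unfolding spectral_sum by eventually_elim (simp add: atLeast0LessThan)
    then show "f \<in> l2_span M (\<lambda>a. translate a \<Phi>) (ker_pow A (Suc j))"
      unfolding spectral_span using f by blast
  qed
  with orth show "l2_orthogonal_direct_sum M (l2_span M (\<lambda>a. translate a \<Phi>) (ker_pow A (Suc j))) W {0..<m}"
    unfolding l2_orthogonal_direct_sum_def by (intro conjI ballI impI set_eqI) auto
qed

end

end

theorem theorem4p2:
  fixes A :: "'a::{topological_ab_group_add, t2_space, second_countable_topology} \<Rightarrow> 'a"
    and M :: "'a measure"
    and V :: "nat \<Rightarrow> ('a \<Rightarrow> complex) set"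
    and \<phi> :: "nat \<Rightarrow> 'a \<Rightarrow> complex"
    and \<pi> :: "nat \<Rightarrow> 'a \<Rightarrow> complex"
    and \<psi> :: "nat \<Rightarrow> nat \<Rightarrow> 'a \<Rightarrow> complex"
    and m j :: nat
  assumes "compact (UNIV :: 'a set)"
    and "normalized_haar_measure M"
    and "continuous_on UNIV A" and "Modules.additive A" and "surj A"
    and "finite (ker_pow A 1)"
    and "closure (\<Union>i. ker_pow A i) = UNIV"
    and "m = card (ker_pow A 1)"
    and "MRA M A V"
    and "orthonormal_scaling_sequence M A V \<phi>"
    and "digit_system A \<pi>"
    and "wavelet_functions M A \<pi> \<phi> \<psi>"
  shows "l2_orthogonal_direct_sum M (V (Suc j))
           (\<lambda>\<nu>. if \<nu> = 0 then V j else wavelet_space M A \<psi> \<nu> j) {0..<m} \<and>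
         (\<forall>\<nu>\<in>{1..<m}. l2_orthonormal_basis M (\<lambda>a. translate a (\<psi> \<nu> j)) (ker_pow A j)
           (wavelet_space M A \<psi> \<nu> j))"
proof -
  have V: "V n = l2_span M (\<lambda>a. translate a (\<phi> n)) (ker_pow A n)" "\<phi> n \<in> V n"
    and on: "l2_orthonormal M (\<lambda>a. translate a (\<phi> n)) (ker_pow A n)" for n
    using assms(10) by (auto simp: orthonormal_scaling_sequence_def scaling_sequence_def l2_basis_def)
  interpret dilation_level M A m \<pi> j "\<phi> (Suc j)"
    using assms(1-8,11) on Modules.additive.add[OF assms(4)] by unfold_locales auto
  from assms(12) obtain B \<alpha> where
    B: "\<forall>j. \<forall>\<eta>\<in>digits A \<pi> j. unitary_matrix m (B j \<eta>) \<and>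
      (\<forall>k<m. B j \<eta> 0 k = mask M A \<phi> j (digit_char j \<eta> k) / of_real (sqrt (real m)))"
    and \<alpha>: "\<forall>j. \<forall>\<nu>\<in>{1..<m}. \<forall>\<eta>\<in>digits A \<pi> j. \<forall>k<m.
        \<alpha> \<nu> j (digit_char j \<eta> k) = of_real (sqrt (real m)) * B j \<eta> \<nu> k"
      "\<forall>j. \<forall>\<nu>\<in>{1..<m}. \<forall>\<eta>\<in>digits A \<pi> (Suc j).
        \<forall>\<xi>\<in>char_coset (annihilator (ker_pow A (Suc j))) \<eta>. \<alpha> \<nu> j \<xi> = \<alpha> \<nu> j \<eta>"
    and \<psi>: "\<forall>j. \<forall>\<nu>\<in>{1..<m}. \<psi> \<nu> j \<in> L2 M \<and>
        (\<forall>\<xi>\<in>dual_group. fourier M (\<psi> \<nu> j) \<xi> = \<alpha> \<nu> j \<xi> * fourier M (\<phi> (Suc j)) \<xi>)"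
    unfolding wavelet_functions_def Let_def m_def[symmetric] by (elim exE conjE)
  have "V j \<subseteq> V (Suc j)" using assms(9) by (simp add: MRA_def)
  then have "\<phi> j \<in> V (Suc j)" using V(2) by blast
  then obtain \<beta>0 where \<beta>0: "\<phi> j \<in> L2 M" "AE x in M. \<phi> j x = spectral \<beta>0 x"
    unfolding V(1) spectral_span by blast
  define \<beta> where "\<beta> \<nu> = (if \<nu> = 0 then \<beta>0 else \<alpha> \<nu> j)" for \<nu>
  define \<psi>' where "\<psi>' \<nu> = (if \<nu> = 0 then \<phi> j else \<psi> \<nu> j)" for \<nu>
  have \<beta>: "\<beta> \<nu> (digit_char j \<eta> k) = of_real (sqrt (real m)) * B j \<eta> \<nu> k"
    if "\<nu> < m" "\<eta> \<in> digits A \<pi> j" "k < m" for \<nu> \<eta> k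
  proof (cases "\<nu> = 0")
    case True
    have "digit_char j \<eta> k \<in> digits A \<pi> (Suc j)"
      unfolding digits_Suc_image using that by auto
    from mask_eq_coefficient[of \<phi>, OF refl \<beta>0 this] show ?thesis
      using True B that m_pos by (simp add: \<beta>_def)
  next
    case False
    then show ?thesis using \<alpha>(1) that by (simp add: \<beta>_def)
  qed
  have L2: "\<psi>' \<nu> \<in> L2 M" if "\<nu> < m" for \<nu>
    using \<beta>0 \<psi> that by (simp add: \<psi>'_def)
  have AE: "AE x in M. \<psi>' \<nu> x = spectral (\<beta> \<nu>) x" if "\<nu> < m" for \<nu>
  proof (cases "\<nu> = 0")
    case True
    then show ?thesis using \<beta>0 by (simp add: \<psi>'_def \<beta>_def)
  next
    case False
    then have \<nu>: "\<nu> \<in> {1..<m}" using that by simp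
    show ?thesis
    proof (rule fourier_inj[OF L2[OF that] spectral_L2])
      fix \<xi> :: "'a \<Rightarrow> complex" assume \<xi>: "\<xi> \<in> dual_group"
      obtain \<eta> where \<eta>: "\<eta> \<in> digits A \<pi> (Suc j)" "\<And>a. a \<in> ker_pow A (Suc j) \<Longrightarrow> \<xi> a = \<eta> a"
        using digit_representative[OF \<xi>, of "Suc j"] by blast
      then have "\<xi> \<in> char_coset (annihilator (ker_pow A (Suc j))) \<eta>"
        using \<xi> by (simp add: char_coset_annihilator[OF D_dual])
      then show "fourier M (\<psi>' \<nu>) \<xi> = fourier M (spectral (\<beta> \<nu>)) \<xi>"
        using \<psi> \<alpha>(2) \<nu> \<xi> \<eta>(1) False fourier_spectral[OF \<xi> \<eta>]
        by (simp add: \<psi>'_def \<beta>_def)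
    qed
  qed
  have W: "(\<lambda>\<nu>. l2_span M (\<lambda>a. translate a (\<psi>' \<nu>)) (ker_pow A j)) =
      (\<lambda>\<nu>. if \<nu> = 0 then V j else wavelet_space M A \<psi> \<nu> j)"
    by (auto simp: \<psi>'_def V(1)[of j] wavelet_space_def fun_eq_iff)
  note decomposition = wavelet_decomposition[of "B j" \<beta> \<psi>', OF _ \<beta> L2 AE, unfolded W]
  show ?thesis
  proof (intro conjI ballI)
    show "l2_orthogonal_direct_sum M (V (Suc j))
        (\<lambda>\<nu>. if \<nu> = 0 then V j else wavelet_space M A \<psi> \<nu> j) {0..<m}"
      using decomposition(1) B unfolding V(1)[of "Suc j"] by simp
  next
    fix \<nu> assume "\<nu> \<in> {1..<m}"
    then show "l2_orthonormal_basis M (\<lambda>a. translate a (\<psi> \<nu> j)) (ker_pow A j) (wavelet_space M A \<psi> \<nu> j)"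
      using decomposition(2)[of \<nu>] B by (simp add: \<psi>'_def wavelet_space_def)
  qed
qed

end
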